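(* Let $K$ be a field of characteristic zero, let $n\ge 1$, let $\varphi$ be a $K$-algebra endomorphism of the $n$-th Weyl algebra $A=A_n(K)$, and let $S=\varphi(A)$ denote the image of $\varphi$. Then the dimension of $Q(A)$ as a left module over $Q(S)$ is less than or equal to $(\deg\varphi)^{2n}$, and likewise the dimension of $Q(A)$ as a right module over $Q(S)$ is less than or equal to $(\deg\varphi)^{2n}$.
   Context: For a commutative ring $R$, the $n$-th Weyl algebra $A_n(R)$ is the $R$-algebra generated freely by $x_1,\dots,x_n,\partial_1,\dots,\partial_n$ subject to the relations $[x_i,x_j]=0$, $[\partial_i,\partial_j]=0$, $[\partial_i,x_j]=\delta_{ij}$ for $1\le i,j\le n$, where $[a,b]=ab-ba$. It is a free $R$-module with basis the monomials $x^\alpha\partial^\beta=x_1^{\alpha_1}\cdots x_n^{\alpha_n}\partial_1^{\beta_1}\cdots\partial_n^{\beta_n}$, $\alpha,\beta\in\mathbb{N}^n$ (with $0\in\mathbb{N}$). The degree of the monomial $x^\alpha\partial^\beta$ is $|\alpha|+|\beta|=\sum_i\alpha_i+\sum_i\beta_i$; the degree $\deg f$ of a nonzero $f\in A_n(R)$ is the maximum of the degrees of the monomials occurring with nonzero coefficient in its expansion in the monomial basis. The degree of an endomorphism $\varphi$ of $A_n(R)$ is $$\deg\varphi=\max\{\deg\varphi(x_1),\deg\varphi(\partial_1),\dots,\deg\varphi(x_n),\deg\varphi(\partial_n)\}.$$ For a (left and right) Ore domain $A$, $Q(A)$ denotes its division ring of fractions. The Weyl algebra $A=A_n(K)$ is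 an Ore domain; since it is simple when $K$ has characteristic zero, $\varphi$ is injective, so $S\cong A$ is also an Ore domain and the inclusion $S\subset A$ induces an extension of division rings $Q(S)\subset Q(A)$. *)

theory Defs
  imports
    Complex_Main
    "HOL-Library.Poly_Mapping"
    "HOL-Library.Extended_Nat"
    "HOL-Library.Numeral_Type"
begin

section \<open>Free algebras\<close>

text \<open>
  The free monoid on \<^typ>\<open>'a\<close>, written additively: \<^const>\<open>times\<close> on
  \<open>'m \<Rightarrow>\<^sub>0 'k\<close> is the convolution product for a monoid of class \<open>monoid_add\<close> (which need not
  be commutative), so that \<open>'a free_monoid \<Rightarrow>\<^sub>0 'k\<close> is the free associative
  \<open>'k\<close>-algebra on \<^typ>\<open>'a\<close>.
\<close>

datatype 'a free_monoid = Word (letters: "'a list")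

instantiation free_monoid :: (type) monoid_add
begin

definition "0 = Word []"
definition "u + v = Word (letters u @ letters v)"

instance
  by standard (simp_all add: zero_free_monoid_def plus_free_monoid_def)

end

type_synonym ('a, 'k) free_algebra = "'a free_monoid \<Rightarrow>\<^sub>0 'k"

definition free_gen :: "'a \<Rightarrow> ('a, 'k::comm_ring_1) free_algebra" where
  "free_gen a = Poly_Mapping.single (Word [a]) 1"

definition free_const :: "'k \<Rightarrow> ('a, 'k::comm_ring_1) free_algebra" where
  "free_const c = Poly_Mapping.single 0 c"

inductive_set two_sided_ideal :: "'r::ring_1 set \<Rightarrow> 'r set" for R where
  incl: "r \<in> R \<Longrightarrow> r \<in> two_sided_ideal R"
| zero: "0 \<in> two_sided_ideal R"
| add: "\<lbrakk>f \<in> two_sided_ideal R; g \<in> two_sided_ideal R\<rbrakk> \<Longrightarrow> f + g \<in> two_sided_ideal R"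
| left: "f \<in> two_sided_ideal R \<Longrightarrow> h * f \<in> two_sided_ideal R"
| right: "f \<in> two_sided_ideal R \<Longrightarrow> f * h \<in> two_sided_ideal R"

lemma two_sided_ideal_uminus: "f \<in> two_sided_ideal R \<Longrightarrow> - f \<in> two_sided_ideal R"
  using two_sided_ideal.left[of f R "- 1"] by simp

lemma two_sided_ideal_diff:
  "\<lbrakk>f \<in> two_sided_ideal R; g \<in> two_sided_ideal R\<rbrakk> \<Longrightarrow> f - g \<in> two_sided_ideal R"
  using two_sided_ideal.add[of f R "- g"] two_sided_ideal_uminus[of g R] by simp


section \<open>The Weyl algebra\<close>

text \<open>
  The generators \<open>x\<^sub>i\<close>, \<open>\<partial>\<^sub>i\<close> are indexed by a type \<^typ>\<open>'n\<close>. When \<^typ>\<open>'n\<close> is finite,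
  \<open>('n, 'k) weyl\<close> is the \<open>CARD('n)\<close>-th Weyl algebra over \<open>'k\<close>.
\<close>

datatype 'n weyl_gen = GenX 'n | GenD 'n

definition commutator :: "'r::ring \<Rightarrow> 'r \<Rightarrow> 'r" where
  "commutator a b = a * b - b * a"

definition weyl_relations :: "('n weyl_gen, 'k::comm_ring_1) free_algebra set" where
  "weyl_relations =
     {commutator (free_gen (GenX i)) (free_gen (GenX j)) | i j. True} \<union>
     {commutator (free_gen (GenD i)) (free_gen (GenD j)) | i j. True} \<union>
     {commutator (free_gen (GenD i)) (free_gen (GenX j)) - (if i = j then 1 else 0) | i j. True}"

definition weyl_cong ::
  "('n weyl_gen, 'k::comm_ring_1) free_algebra \<Rightarrow> ('n weyl_gen, 'k) free_algebra \<Rightarrow> bool" where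
  "weyl_cong f g \<longleftrightarrow> f - g \<in> two_sided_ideal weyl_relations"

lemma equivp_weyl_cong: "equivp weyl_cong"
proof (rule equivpI)
  show "reflp weyl_cong"
    by (simp add: reflp_def weyl_cong_def two_sided_ideal.zero)
  show "symp weyl_cong"
    unfolding symp_def weyl_cong_def by (metis minus_diff_eq two_sided_ideal_uminus)
  show "transp weyl_cong"
  proof (rule transpI)
    fix f g h :: "('n weyl_gen, 'k::comm_ring_1) free_algebra"
    assume "weyl_cong f g" "weyl_cong g h"
    then have "(f - g) + (g - h) \<in> two_sided_ideal weyl_relations"
      unfolding weyl_cong_def by (rule two_sided_ideal.add)
    then show "weyl_cong f h"
      by (simp add: weyl_cong_def)
  qed
qed

lemma weyl_cong_refl: "weyl_cong f f"
  by (simp add: weyl_cong_def two_sided_ideal.zero)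

quotient_type (overloaded) ('n, 'k) weyl =
  "('n weyl_gen, 'k::comm_ring_1) free_algebra" / weyl_cong
  by (rule equivp_weyl_cong)

text \<open>
  The class \<open>ring_1\<close> would in addition require \<open>0 \<noteq> 1\<close>, which is part of the
  basis theorem for the monomials and is not needed for the definitions below.
\<close>

instantiation weyl :: (type, comm_ring_1) ring
begin

lift_definition zero_weyl :: "('n, 'k::comm_ring_1) weyl" is 0 .

lift_definition plus_weyl :: "('n, 'k::comm_ring_1) weyl \<Rightarrow> ('n, 'k) weyl \<Rightarrow> ('n, 'k) weyl" is "(+)"
  unfolding weyl_cong_def by (metis add_diff_add two_sided_ideal.add)

lift_definition uminus_weyl :: "('n, 'k::comm_ring_1) weyl \<Rightarrow> ('n, 'k) weyl" is uminus
  unfolding weyl_cong_def by (metis minus_diff_minus two_sided_ideal_uminus)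

lift_definition minus_weyl :: "('n, 'k::comm_ring_1) weyl \<Rightarrow> ('n, 'k) weyl \<Rightarrow> ('n, 'k) weyl" is "(-)"
proof -
  fix f f' g g' :: "('n weyl_gen, 'k::comm_ring_1) free_algebra"
  assume "weyl_cong f f'" "weyl_cong g g'"
  then have "(f - f') - (g - g') \<in> two_sided_ideal weyl_relations"
    unfolding weyl_cong_def by (rule two_sided_ideal_diff)
  then show "weyl_cong (f - g) (f' - g')"
    by (simp add: weyl_cong_def algebra_simps)
qed

lift_definition times_weyl :: "('n, 'k::comm_ring_1) weyl \<Rightarrow> ('n, 'k) weyl \<Rightarrow> ('n, 'k) weyl" is "(*)"
proof -
  fix f f' g g' :: "('n weyl_gen, 'k::comm_ring_1) free_algebra"
  assume "weyl_cong f f'" "weyl_cong g g'"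
  then have "(f - f') * g + f' * (g - g') \<in> two_sided_ideal weyl_relations"
    unfolding weyl_cong_def
    by (intro two_sided_ideal.add two_sided_ideal.left two_sided_ideal.right)
  then show "weyl_cong (f * g) (f' * g')"
    by (simp add: weyl_cong_def algebra_simps)
qed

instance
proof
  fix f g h :: "('a, 'b) weyl"
  show "f + g + h = f + (g + h)"
    by transfer (simp add: weyl_cong_refl add.assoc)
  show "f + g = g + f"
    by transfer (metis weyl_cong_refl add.commute)
  show "0 + f = f"
    by transfer (simp add: weyl_cong_refl)
  show "- f + f = 0"
    by transfer (simp add: weyl_cong_refl)
  show "f - g = f + - g"
    by transfer (simp add: weyl_cong_refl)
  show "f * g * h = f * (g * h)"
    by transfer (simp add: weyl_cong_refl mult.assoc)
  show "(f + g) * h = f * h + g * h"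
    by transfer (simp add: weyl_cong_refl distrib_right)
  show "f * (g + h) = f * g + f * h"
    by transfer (simp add: weyl_cong_refl distrib_left)
qed

end

instantiation weyl :: (type, comm_ring_1) monoid_mult
begin

lift_definition one_weyl :: "('n, 'k::comm_ring_1) weyl" is 1 .

instance
proof
  fix f :: "('a, 'b) weyl"
  show "1 * f = f"
    by transfer (simp add: weyl_cong_refl)
  show "f * 1 = f"
    by transfer (simp add: weyl_cong_refl)
qed

end

lift_definition weyl_const :: "'k \<Rightarrow> ('n, 'k::comm_ring_1) weyl" is free_const .

lift_definition weyl_x :: "'n \<Rightarrow> ('n, 'k::comm_ring_1) weyl" is "\<lambda>i. free_gen (GenX i)" .

lift_definition weyl_d :: "'n \<Rightarrow> ('n, 'k::comm_ring_1) weyl" is "\<lambda>i. free_gen (GenD i)" .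

text \<open>
  The linear order on the index type only fixes the order of the factors in
  \<open>x\<^sub>1\<^bsup>\<alpha>\<^sub>1\<^esup> \<dots> x\<^sub>n\<^bsup>\<alpha>\<^sub>n\<^esup> \<partial>\<^sub>1\<^bsup>\<beta>\<^sub>1\<^esup> \<dots> \<partial>\<^sub>n\<^bsup>\<beta>\<^sub>n\<^esup>\<close>.
\<close>

definition weyl_monomial ::
  "('n::{finite,linorder} \<Rightarrow> nat) \<times> ('n \<Rightarrow> nat) \<Rightarrow> ('n, 'k::comm_ring_1) weyl" where
  "weyl_monomial = (\<lambda>(\<alpha>, \<beta>).
     prod_list (map (\<lambda>i. weyl_x i ^ \<alpha> i) (sorted_list_of_set UNIV)) *
     prod_list (map (\<lambda>i. weyl_d i ^ \<beta> i) (sorted_list_of_set UNIV)))"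

definition monomial_degree :: "('n::finite \<Rightarrow> nat) \<times> ('n \<Rightarrow> nat) \<Rightarrow> nat" where
  "monomial_degree = (\<lambda>(\<alpha>, \<beta>). (\<Sum>i\<in>UNIV. \<alpha> i) + (\<Sum>i\<in>UNIV. \<beta> i))"

text \<open>
  The coefficients of the expansion in the monomial basis; that they exist and are unique is the
  statement that the monomials form a basis.
\<close>

definition weyl_coeffs ::
  "('n::{finite,linorder}, 'k::comm_ring_1) weyl \<Rightarrow> (('n \<Rightarrow> nat) \<times> ('n \<Rightarrow> nat)) \<Rightarrow>\<^sub>0 'k" where
  "weyl_coeffs f = (THE c. f =
     (\<Sum>m\<in>Poly_Mapping.keys c. weyl_const (Poly_Mapping.lookup c m) * weyl_monomial m))"

text \<open>The value at \<open>0\<close> is a convention only.\<close>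

definition weyl_degree :: "('n::{finite,linorder}, 'k::comm_ring_1) weyl \<Rightarrow> nat" where
  "weyl_degree f =
     (if f = 0 then 0 else Max (monomial_degree ` Poly_Mapping.keys (weyl_coeffs f)))"

definition weyl_endomorphism ::
  "(('n, 'k::comm_ring_1) weyl \<Rightarrow> ('n, 'k) weyl) \<Rightarrow> bool" where
  "weyl_endomorphism \<phi> \<longleftrightarrow>
     \<phi> 1 = 1 \<and>
     (\<forall>f g. \<phi> (f + g) = \<phi> f + \<phi> g) \<and>
     (\<forall>f g. \<phi> (f * g) = \<phi> f * \<phi> g) \<and>
     (\<forall>c f. \<phi> (weyl_const c * f) = weyl_const c * \<phi> f)"

definition endomorphism_degree ::
  "(('n::{finite,linorder}, 'k::comm_ring_1) weyl \<Rightarrow> ('n, 'k) weyl) \<Rightarrow> nat" where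
  "endomorphism_degree \<phi> =
     Max (range (\<lambda>i. weyl_degree (\<phi> (weyl_x i))) \<union> range (\<lambda>i. weyl_degree (\<phi> (weyl_d i))))"


section \<open>Division rings of fractions\<close>

text \<open>
  \<open>\<iota>\<close> exhibits the division ring \<open>'d\<close> as the (left and right) division ring of fractions of
  the Ore domain \<open>'a\<close>. Such a pair \<open>('d, \<iota>)\<close> is unique up to unique isomorphism.
\<close>

definition division_ring_of_fractions ::
  "('a::{ring, monoid_mult} \<Rightarrow> 'd::division_ring) \<Rightarrow> bool" where
  "division_ring_of_fractions \<iota> \<longleftrightarrow>
     \<iota> 1 = 1 \<and>
     (\<forall>a b. \<iota> (a + b) = \<iota> a + \<iota> b) \<and>
     (\<forall>a b. \<iota> (a * b) = \<iota> a * \<iota> b) \<and>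
     inj \<iota> \<and>
     (\<forall>q. \<exists>s a. s \<noteq> 0 \<and> q = inverse (\<iota> s) * \<iota> a) \<and>
     (\<forall>q. \<exists>s a. s \<noteq> 0 \<and> q = \<iota> a * inverse (\<iota> s))"

text \<open>
  For a subring \<open>S\<close> of \<open>'a\<close> that is itself an Ore domain, this is \<open>Q(S)\<close>, realised inside
  \<open>'d = Q('a)\<close> as the image of the embedding induced by the inclusion of \<open>S\<close>.
\<close>

definition fractions_of ::
  "('a::{ring, monoid_mult} \<Rightarrow> 'd::division_ring) \<Rightarrow> 'a set \<Rightarrow> 'd set" where
  "fractions_of \<iota> S = {inverse (\<iota> s) * \<iota> a | s a. s \<in> S \<and> a \<in> S \<and> s \<noteq> 0}"


section \<open>Dimension over a division subring\<close>

text \<open>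
  The underlying additive group of \<open>'d\<close>, with scalars from a division subring \<open>E\<close> acting by
  \<open>scale\<close>, which is multiplication on the left or on the right. The locale \<open>vector_space\<close> of the
  library covers commutative scalars only.
\<close>

definition span_over :: "'d::division_ring set \<Rightarrow> ('d \<Rightarrow> 'd \<Rightarrow> 'd) \<Rightarrow> 'd set \<Rightarrow> 'd set" where
  "span_over E scale B =
     {\<Sum>b\<in>F. scale (c b) b | F c. finite F \<and> F \<subseteq> B \<and> (\<forall>b\<in>F. c b \<in> E)}"

definition independent_over :: "'d::division_ring set \<Rightarrow> ('d \<Rightarrow> 'd \<Rightarrow> 'd) \<Rightarrow> 'd set \<Rightarrow> bool" where
  "independent_over E scale B \<longleftrightarrow>
     (\<forall>F c. finite F \<and> F \<subseteq> B \<and> (\<forall>b\<in>F. c b \<in> E) \<and> (\<Sum>b\<in>F. scale (c b) b) = 0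
        \<longrightarrow> (\<forall>b\<in>F. c b = 0))"

definition basis_over :: "'d::division_ring set \<Rightarrow> ('d \<Rightarrow> 'd \<Rightarrow> 'd) \<Rightarrow> 'd set \<Rightarrow> bool" where
  "basis_over E scale B \<longleftrightarrow> independent_over E scale B \<and> span_over E scale B = UNIV"

definition dim_over :: "'d::division_ring set \<Rightarrow> ('d \<Rightarrow> 'd \<Rightarrow> 'd) \<Rightarrow> enat" where
  "dim_over E scale =
     (if \<exists>B. finite B \<and> basis_over E scale B
      then enat (card (SOME B. finite B \<and> basis_over E scale B)) else \<infinity>)"

definition left_dim :: "'d::division_ring set \<Rightarrow> enat" where
  "left_dim E = dim_over E (\<lambda>c v. c * v)"

definition right_dim :: "'d::division_ring set \<Rightarrow> enat" where
  "right_dim E = dim_over E (\<lambda>c v. v * c)"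

end

theory Submission
  imports Defs
begin

text \<open>
  Monomials in elements that satisfy the Weyl relations are linearly independent in characteristic
  zero, because iterated commutators with the dual generators single out any coefficient of top
  degree. This gives the basis theorem and the injectivity of \<open>\<phi>\<close>.

  Let \<open>V N\<close> be the span of the monomials of degree at most \<open>N\<close>, and let \<open>d = deg \<phi>\<close>, so that \<open>\<phi>\<close> maps
  \<open>V N\<close> into \<open>V (d N)\<close>. After clearing denominators, \<open>m\<close> elements of \<open>Q(A)\<close> that are independent over
  \<open>Q(S)\<close> become \<open>a\<^sub>1, \<dots>, a\<^sub>m \<in> V c\<close> that are independent over \<open>S\<close>, and
  \<open>(f\<^sub>1, \<dots>, f\<^sub>m) \<mapsto> \<Sum>\<^sub>i \<phi> (f\<^sub>i) a\<^sub>i\<close> embeds \<open>(V N)\<^sup>m\<close> into \<open>V (d N + c)\<close>. As \<open>V N\<close> has dimension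
  \<open>(N + 2 n) choose (2 n)\<close>, comparing the growth in \<open>N\<close> yields \<open>m \<le> d\<^bsup>2 n\<^esup>\<close>.
\<close>

section \<open>Dimension over a division subring\<close>

lemma independent_overD:
  assumes "independent_over E scale B" "finite B"
    and "\<And>b. b \<in> B \<Longrightarrow> c b \<in> E" "(\<Sum>b\<in>B. scale (c b) b) = 0" "b \<in> B"
  shows "c b = 0"
  using assms unfolding independent_over_def by (metis order_refl)

text \<open>\<open>scale\<close> stands for multiplication from either side, and the hypotheses are
  what both sides share; \<open>quot\<close> provides \<open>- (inverse a * b)\<close> or
  \<open>- (b * inverse a)\<close>. A largest independent set exists by \<open>bound\<close> and
  spans by maximality, and \<open>bound\<close> applies to whichever finite basis
  \<open>SOME\<close> selects.\<close>

lemma dim_over_le: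
  fixes E :: "'d::division_ring set"
  assumes add: "\<And>c u v. scale c (u + v) = scale c u + scale c v"
    and one: "1 \<in> E" "\<And>v. scale 1 v = v"
    and zero_scalar: "0 \<in> E" "\<And>v. scale 0 v = 0"
    and inj: "\<And>c v. scale c v = 0 \<Longrightarrow> c = 0 \<or> v = 0"
    and quot: "\<And>a b. a \<in> E \<Longrightarrow> b \<in> E \<Longrightarrow> a \<noteq> 0 \<Longrightarrow> \<exists>e\<in>E. \<forall>v. scale a (scale e v) = - scale b v"
    and bound: "\<And>B. finite B \<Longrightarrow> independent_over E scale B \<Longrightarrow> card B \<le> M"
  shows "dim_over E scale \<le> enat M"
proof -
  have zero: "scale c 0 = 0" for c
    using add[of c 0 0] by simp
  have sum: "scale c (sum f F) = (\<Sum>b\<in>F. scale c (f b))" for c F and f :: "'d \<Rightarrow> 'd"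
    by (induction F rule: infinite_finite_induct) (simp_all add: zero add)
  have diff: "scale c (u - v) = scale c u - scale c v" for c u v
    using add[of c "u - v" v] by (simp add: algebra_simps)
  define P where "P = (\<lambda>k. \<exists>B. finite B \<and> independent_over E scale B \<and> card B = k)"
  have "P 0"
    unfolding P_def by (intro exI[of _ "{}"]) (simp add: independent_over_def)
  moreover have "\<forall>k. P k \<longrightarrow> k \<le> M"
    unfolding P_def using bound by blast
  ultimately have "P (Greatest P)" "\<And>k. P k \<Longrightarrow> k \<le> Greatest P"
    using GreatestI_nat Greatest_le_nat by metis+
  then obtain B where B: "finite B" "independent_over E scale B"
    and max: "\<And>C. finite C \<Longrightarrow> independent_over E scale C \<Longrightarrow> card C \<le> card B"
    unfolding P_def by metis
  have "v \<in> span_over E scale B" for v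
  proof (cases "v \<in> B")
    case True
    then show ?thesis
      unfolding span_over_def
      by (intro CollectI exI[of _ "{v}"] exI[of _ "\<lambda>_. 1"]) (simp add: one)
  next
    case False
    then have "\<not> independent_over E scale (insert v B)"
      using max[of "insert v B"] B(1) by auto
    then obtain F c where F: "finite F" "F \<subseteq> insert v B" "\<forall>b\<in>F. c b \<in> E"
      "(\<Sum>b\<in>F. scale (c b) b) = 0" and nz: "\<exists>b\<in>F. c b \<noteq> 0"
      unfolding independent_over_def by blast
    define G where "G = F - {v}"
    have G: "finite G" "G \<subseteq> B" "v \<notin> G" "\<forall>b\<in>G. c b \<in> E"
      using F by (auto simp: G_def)
    have v: "v \<in> F \<and> c v \<noteq> 0"
    proof (rule ccontr)
      assume a: "\<not> (v \<in> F \<and> c v \<noteq> 0)"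
      then have "(\<Sum>b\<in>G. scale (c b) b) = (\<Sum>b\<in>F. scale (c b) b)"
        unfolding G_def by (intro sum.mono_neutral_left) (auto simp: F zero_scalar)
      then have "\<forall>b\<in>G. c b = 0"
        using G B(2) F(4) unfolding independent_over_def by metis
      with nz a show False
        by (auto simp: G_def)
    qed
    then have "scale (c v) v + (\<Sum>b\<in>G. scale (c b) b) = 0"
      using F(1,4) sum.remove[OF F(1), of v "\<lambda>b. scale (c b) b"] by (simp add: G_def)
    \<comment> \<open>The \<open>e b\<close> are the coefficients obtained on dividing the relation
      by \<open>c v\<close>, on whichever side the scalars act.\<close>
    moreover have "\<forall>b\<in>G. \<exists>e\<in>E. \<forall>u. scale (c v) (scale e u) = - scale (c b) u"
      using quot v F(3) G(4) by blast
    then obtain e where e: "\<And>b. b \<in> G \<Longrightarrow> e b \<in> E"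
      "\<And>b u. b \<in> G \<Longrightarrow> scale (c v) (scale (e b) u) = - scale (c b) u"
      by metis
    ultimately have "scale (c v) (v - (\<Sum>b\<in>G. scale (e b) b)) = 0"
      by (simp add: diff sum sum_negf)
    then have "v = (\<Sum>b\<in>G. scale (e b) b)"
      using inj v by fastforce
    then show ?thesis
      unfolding span_over_def using G(1,2) e(1) by (intro CollectI exI[of _ G] exI[of _ e]) auto
  qed
  then have "finite B \<and> basis_over E scale B"
    using B by (auto simp: basis_over_def)
  then have ex: "\<exists>B. finite B \<and> basis_over E scale B"
    by blast
  then have "card (SOME B. finite B \<and> basis_over E scale B) \<le> M"
    using someI_ex[OF ex] bound unfolding basis_over_def by blast
  with ex show ?thesis
    by (simp add: dim_over_def)
qed

section \<open>Division rings of fractions\<close>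

lemma division_ring_of_fractionsD:
  assumes "division_ring_of_fractions \<iota>"
  shows "\<iota> 1 = 1" "\<iota> (a + b) = \<iota> a + \<iota> b" "\<iota> (a * b) = \<iota> a * \<iota> b" "inj \<iota>"
  using assms unfolding division_ring_of_fractions_def by blast+

lemma division_ring_of_fractions_zero:
  assumes "division_ring_of_fractions \<iota>"
  shows "\<iota> 0 = 0"
  using division_ring_of_fractionsD(2)[OF assms, of 0 0] by simp

lemma division_ring_of_fractions_eq_0_iff:
  assumes "division_ring_of_fractions \<iota>"
  shows "\<iota> a = 0 \<longleftrightarrow> a = 0"
  using division_ring_of_fractions_zero[OF assms] division_ring_of_fractionsD(4)[OF assms]
  by (metis injD)

lemma division_ring_of_fractions_sum:
  assumes "division_ring_of_fractions \<iota>"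
  shows "\<iota> (sum f F) = (\<Sum>i\<in>F. \<iota> (f i))"
  by (induction F rule: infinite_finite_induct)
    (simp_all add: division_ring_of_fractionsD(2)[OF assms] division_ring_of_fractions_zero[OF assms])

text \<open>The right fraction of \<open>s\<close> by \<open>t\<close> is rewritten as a left
  fraction with denominator \<open>u\<close>. Clearing both denominators gives a relation inside
  \<open>'a\<close>, because \<open>\<iota>\<close> is injective.\<close>

lemma left_ore_condition:
  fixes \<iota> :: "'a::{ring, monoid_mult} \<Rightarrow> 'd::division_ring" and s t :: 'a
  assumes \<iota>: "division_ring_of_fractions \<iota>" and "t \<noteq> 0"
  shows "\<exists>u v. u \<noteq> 0 \<and> u * s = v * t"
proof -
  note mult = division_ring_of_fractionsD(3)[OF \<iota>]
  obtain u v where uv: "u \<noteq> 0" "\<iota> s * inverse (\<iota> t) = inverse (\<iota> u) * \<iota> v"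
    using \<iota> unfolding division_ring_of_fractions_def by blast
  have nz: "\<iota> t \<noteq> 0" "\<iota> u \<noteq> 0"
    using assms uv(1) by (simp_all add: division_ring_of_fractions_eq_0_iff)
  have "\<iota> u * \<iota> s = \<iota> u * (\<iota> s * inverse (\<iota> t)) * \<iota> t"
    using nz by (simp add: mult.assoc)
  also have "\<dots> = \<iota> v * \<iota> t"
    unfolding uv(2) mult.assoc[symmetric] using nz by simp
  finally have "u * s = v * t"
    using division_ring_of_fractionsD(4)[OF \<iota>] by (metis injD mult)
  with uv(1) show ?thesis
    by blast
qed

text \<open>If \<open>s\<close> clears \<open>F\<close> and \<open>q * \<iota> s\<close> has right
  denominator \<open>u\<close>, then \<open>s * u\<close> clears \<open>q\<close> as well.
  Multiplying on the right leaves coefficients on the left alone, which serves the left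
  dimension.\<close>

lemma common_right_denominator:
  assumes \<iota>: "division_ring_of_fractions \<iota>" and "finite F"
  shows "\<exists>s. s \<noteq> 0 \<and> (\<forall>q\<in>F. q * \<iota> s \<in> range \<iota>)"
  using assms(2)
proof induction
  case empty
  have "\<iota> 1 \<noteq> \<iota> 0"
    using division_ring_of_fractions_zero[OF \<iota>] division_ring_of_fractionsD(1)[OF \<iota>] by simp
  then show ?case
    by (intro exI[of _ 1]) auto
next
  case (insert q F)
  note mult = division_ring_of_fractionsD(3)[OF \<iota>]
  obtain s where s: "s \<noteq> 0" "\<And>q. q \<in> F \<Longrightarrow> q * \<iota> s \<in> range \<iota>"
    using insert.IH by blast
  obtain u a where u: "u \<noteq> 0" "q * \<iota> s = \<iota> a * inverse (\<iota> u)"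
    using \<iota> unfolding division_ring_of_fractions_def by blast
  have nz: "\<iota> u \<noteq> 0"
    using \<iota> u(1) by (simp add: division_ring_of_fractions_eq_0_iff)
  have "q' * \<iota> (s * u) \<in> range \<iota>" if "q' \<in> insert q F" for q'
  proof (cases "q' = q")
    case True
    then have "q' * \<iota> (s * u) = \<iota> a"
      using u(2) nz by (simp add: mult mult.assoc[symmetric]) (simp add: mult.assoc)
    then show ?thesis
      by simp
  next
    case False
    then have "q' * \<iota> s \<in> range \<iota>"
      using s(2) that by simp
    then obtain b where "q' * \<iota> s = \<iota> b"
      by blast
    then have "q' * \<iota> (s * u) = \<iota> (b * u)"
      by (simp add: mult mult.assoc[symmetric])
    then show ?thesis
      by simp
  qed
  moreover have "\<iota> (s * u) \<noteq> 0"
    using \<iota> s(1) u(1) by (simp add: mult division_ring_of_fractions_eq_0_iff)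
  then have "s * u \<noteq> 0"
    using division_ring_of_fractions_zero[OF \<iota>] by auto
  ultimately show ?case
    by blast
qed

text \<open>The mirror image of \<open>common_right_denominator\<close>: the new factor goes to the
  left of \<open>s\<close>, so coefficients on the right stay untouched.\<close>

lemma common_left_denominator:
  assumes \<iota>: "division_ring_of_fractions \<iota>" and "finite F"
  shows "\<exists>s. s \<noteq> 0 \<and> (\<forall>q\<in>F. \<iota> s * q \<in> range \<iota>)"
  using assms(2)
proof induction
  case empty
  have "\<iota> 1 \<noteq> \<iota> 0"
    using division_ring_of_fractions_zero[OF \<iota>] division_ring_of_fractionsD(1)[OF \<iota>] by simp
  then show ?case
    by (intro exI[of _ 1]) auto
next
  case (insert q F)
  note mult = division_ring_of_fractionsD(3)[OF \<iota>]
  obtain s where s: "s \<noteq> 0" "\<And>q. q \<in> F \<Longrightarrow> \<iota> s * q \<in> range \<iota>"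
    using insert.IH by blast
  obtain u a where u: "u \<noteq> 0" "\<iota> s * q = inverse (\<iota> u) * \<iota> a"
    using \<iota> unfolding division_ring_of_fractions_def by blast
  have nz: "\<iota> u \<noteq> 0"
    using \<iota> u(1) by (simp add: division_ring_of_fractions_eq_0_iff)
  have "\<iota> (u * s) * q' \<in> range \<iota>" if "q' \<in> insert q F" for q'
  proof (cases "q' = q")
    case True
    then have "\<iota> (u * s) * q' = \<iota> a"
      using u(2) nz by (simp add: mult mult.assoc) (simp add: mult.assoc[symmetric])
    then show ?thesis
      by simp
  next
    case False
    then have "\<iota> s * q' \<in> range \<iota>"
      using s(2) that by simp
    then obtain b where "\<iota> s * q' = \<iota> b"
      by blast
    then have "\<iota> (u * s) * q' = \<iota> (u * b)"
      by (simp add: mult mult.assoc)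
    then show ?thesis
      by simp
  qed
  moreover have "\<iota> (u * s) \<noteq> 0"
    using \<iota> s(1) u(1) by (simp add: mult division_ring_of_fractions_eq_0_iff)
  then have "u * s \<noteq> 0"
    using division_ring_of_fractions_zero[OF \<iota>] by auto
  ultimately show ?case
    by blast
qed

section \<open>Closure properties of the fractions of an image\<close>

context
  fixes \<iota> :: "'a::{ring, monoid_mult} \<Rightarrow> 'd::division_ring" and \<phi> :: "'a \<Rightarrow> 'a"
  assumes \<iota>: "division_ring_of_fractions \<iota>"
    and \<phi>_one: "\<phi> 1 = 1"
    and \<phi>_mult: "\<phi> (a * b) = \<phi> a * \<phi> b"
    and \<phi>_uminus: "\<phi> (- a) = - \<phi> a"
    and \<phi>_eq_0: "\<phi> a = 0 \<longleftrightarrow> a = 0"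
begin

lemma fractions_of_range_iff:
  "q \<in> fractions_of \<iota> (range \<phi>) \<longleftrightarrow> (\<exists>s a. s \<noteq> 0 \<and> q = inverse (\<iota> (\<phi> s)) * \<iota> (\<phi> a))"
  unfolding fractions_of_def using \<phi>_eq_0 by blast

lemma image_mem_fractions_of_range: "\<iota> (\<phi> a) \<in> fractions_of \<iota> (range \<phi>)"
proof -
  have "\<iota> 1 = 1" "(1::'a) \<noteq> 0"
    using division_ring_of_fractions_zero[OF \<iota>] division_ring_of_fractionsD(1)[OF \<iota>] by auto
  then show ?thesis
    unfolding fractions_of_range_iff by (intro exI[of _ 1] exI[of _ a]) (simp add: \<phi>_one)
qed

lemma one_mem_fractions_of_range: "1 \<in> fractions_of \<iota> (range \<phi>)"
  using image_mem_fractions_of_range[of 1]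
  by (simp add: \<phi>_one division_ring_of_fractionsD(1)[OF \<iota>])

lemma zero_mem_fractions_of_range: "0 \<in> fractions_of \<iota> (range \<phi>)"
  using image_mem_fractions_of_range[of 0] \<phi>_eq_0[of 0] division_ring_of_fractions_zero[OF \<iota>]
  by simp

text \<open>The inner factor \<open>\<iota> (\<phi> a) * inverse (\<iota> (\<phi> q))\<close>
  becomes a left fraction by the Ore condition for \<open>a\<close> and \<open>q\<close>, which
  holds in \<open>'a\<close> and is carried to the image by \<open>\<phi>\<close>.\<close>

lemma fractions_of_range_product:
  assumes "s \<noteq> 0" "q \<noteq> 0"
  shows "inverse (\<iota> (\<phi> s)) * \<iota> (\<phi> a) * (inverse (\<iota> (\<phi> q)) * \<iota> (\<phi> b)) \<in> fractions_of \<iota> (range \<phi>)"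
proof -
  note mult = division_ring_of_fractionsD(3)[OF \<iota>]
  have nz: "\<iota> (\<phi> x) \<noteq> 0" if "x \<noteq> 0" for x
    using that by (simp add: \<phi>_eq_0 division_ring_of_fractions_eq_0_iff[OF \<iota>])
  obtain u v where uv: "u \<noteq> 0" "u * a = v * q"
    using left_ore_condition[OF \<iota> assms(2)] by blast
  have "\<iota> (\<phi> u) * \<iota> (\<phi> a) = \<iota> (\<phi> v) * \<iota> (\<phi> q)"
    using uv(2) by (metis \<phi>_mult mult)
  then have "inverse (\<iota> (\<phi> u)) * (\<iota> (\<phi> u) * \<iota> (\<phi> a)) * inverse (\<iota> (\<phi> q)) =
      inverse (\<iota> (\<phi> u)) * (\<iota> (\<phi> v) * \<iota> (\<phi> q)) * inverse (\<iota> (\<phi> q))"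
    by simp
  then have swap: "\<iota> (\<phi> a) * inverse (\<iota> (\<phi> q)) = inverse (\<iota> (\<phi> u)) * \<iota> (\<phi> v)"
    unfolding mult.assoc using nz[OF uv(1)] nz[OF assms(2)]
    by (simp add: mult.assoc[symmetric])
  have "inverse (\<iota> (\<phi> s)) * \<iota> (\<phi> a) * (inverse (\<iota> (\<phi> q)) * \<iota> (\<phi> b)) =
      inverse (\<iota> (\<phi> s)) * (inverse (\<iota> (\<phi> u)) * \<iota> (\<phi> v)) * \<iota> (\<phi> b)"
    unfolding swap[symmetric] by (simp add: mult.assoc)
  also have "\<dots> = inverse (\<iota> (\<phi> (u * s))) * \<iota> (\<phi> (v * b))"
    using nz[OF uv(1)] nz[OF assms(1)]
    by (simp add: \<phi>_mult mult nonzero_inverse_mult_distrib mult.assoc)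
  finally have eq: "inverse (\<iota> (\<phi> s)) * \<iota> (\<phi> a) * (inverse (\<iota> (\<phi> q)) * \<iota> (\<phi> b)) =
      inverse (\<iota> (\<phi> (u * s))) * \<iota> (\<phi> (v * b))" .
  have "\<iota> (\<phi> (u * s)) \<noteq> 0"
    using nz[OF uv(1)] nz[OF assms(1)] by (simp add: \<phi>_mult mult)
  then have "u * s \<noteq> 0"
    by (simp add: \<phi>_eq_0 division_ring_of_fractions_eq_0_iff[OF \<iota>])
  with eq show ?thesis
    unfolding fractions_of_range_iff by blast
qed

lemma fractions_of_range_mult:
  assumes "p \<in> fractions_of \<iota> (range \<phi>)" "q \<in> fractions_of \<iota> (range \<phi>)"
  shows "p * q \<in> fractions_of \<iota> (range \<phi>)"
  using assms fractions_of_range_product unfolding fractions_of_range_iff by fast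

lemma fractions_of_range_inverse:
  assumes "p \<in> fractions_of \<iota> (range \<phi>)" "p \<noteq> 0"
  shows "inverse p \<in> fractions_of \<iota> (range \<phi>)"
proof -
  obtain s a where p: "s \<noteq> 0" "p = inverse (\<iota> (\<phi> s)) * \<iota> (\<phi> a)"
    using assms(1) unfolding fractions_of_range_iff by blast
  then have "\<iota> (\<phi> a) \<noteq> 0" "\<iota> (\<phi> s) \<noteq> 0"
    using assms(2) by (auto simp: \<phi>_eq_0 division_ring_of_fractions_eq_0_iff[OF \<iota>])
  then show ?thesis
    unfolding fractions_of_range_iff
    by (intro exI[of _ a] exI[of _ s])
      (auto simp: p(2) nonzero_inverse_mult_distrib \<phi>_eq_0 division_ring_of_fractions_eq_0_iff[OF \<iota>])
qed

text \<open>Since \<open>- p = (\<iota> (\<phi> (- 1))) * p\<close> would need additivity of \<open>\<phi>\<close>, negation is handled separately.\<close>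

lemma fractions_of_range_uminus:
  assumes "p \<in> fractions_of \<iota> (range \<phi>)"
  shows "- p \<in> fractions_of \<iota> (range \<phi>)"
proof -
  note one = division_ring_of_fractionsD(1)[OF \<iota>] and add = division_ring_of_fractionsD(2)[OF \<iota>]
  have "\<iota> (- 1) + \<iota> 1 = 0"
    using division_ring_of_fractions_zero[OF \<iota>] by (simp flip: add)
  then have "\<iota> (\<phi> (- 1)) = - 1"
    by (simp add: \<phi>_uminus \<phi>_one one eq_neg_iff_add_eq_0)
  then show ?thesis
    using fractions_of_range_mult[OF image_mem_fractions_of_range[of "- 1"] assms] by simp
qed

end

section \<open>Constants of the Weyl algebra\<close>

lemma weyl_const_0: "weyl_const 0 = 0"
  by transfer (simp add: free_const_def weyl_cong_refl)

lemma weyl_const_1: "weyl_const 1 = 1"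
  by transfer (simp add: free_const_def weyl_cong_refl)

lemma weyl_const_add: "weyl_const (a + b) = weyl_const a + weyl_const b"
  by transfer (simp add: free_const_def weyl_cong_refl single_add)

lemma weyl_const_mult: "weyl_const (a * b) = weyl_const a * weyl_const b"
  by transfer (simp add: free_const_def weyl_cong_refl mult_single)

text \<open>An update at a key outside the support adds a single term, so
  \<open>update_induct\<close> becomes induction along sums of terms. Additive statements about the
  free algebra thereby reduce to words.\<close>

lemma poly_mapping_single_add_induct [case_names zero single add]:
  fixes f :: "'a \<Rightarrow>\<^sub>0 'k::monoid_add"
  assumes "P 0" and "\<And>w a. P (Poly_Mapping.single w a)" and "\<And>f g. P f \<Longrightarrow> P g \<Longrightarrow> P (f + g)"
  shows "P f"
proof (induction f rule: update_induct)
  case const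
  show ?case
    using assms(1) .
next
  case (update f w a)
  have "Poly_Mapping.update w a f = f + Poly_Mapping.single w a"
    using update by (intro poly_mapping_eqI) (auto simp: lookup_update lookup_add lookup_single in_keys_iff)
  then show ?case
    using assms(2,3) update by simp
qed

lemma free_const_commute: "free_const c * f = f * free_const c"
  by (induction f rule: poly_mapping_single_add_induct)
    (simp_all add: free_const_def mult_single mult.commute distrib_left distrib_right)

lemma weyl_const_commute: "weyl_const c * f = f * weyl_const c"
  by transfer (simp add: free_const_commute weyl_cong_refl)

lemma weyl_const_left_commute: "f * (weyl_const c * g) = weyl_const c * (f * g)"
  by (metis mult.assoc weyl_const_commute)

interpretation weyl: vector_space "\<lambda>(c::'k::field) (f::('n, 'k) weyl). weyl_const c * f"
  by standard (simp_all add: distrib_left distrib_right weyl_const_add weyl_const_mult weyl_const_1 mult.assoc)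

text \<open>Nontriviality of the Weyl algebra is carried along as a hypothesis; in
  \<open>proposition4p2\<close> it is read off from \<open>\<iota>\<close>.\<close>

lemma weyl_const_eq_0_iff:
  assumes "(1::('n, 'k::field) weyl) \<noteq> 0"
  shows "(weyl_const c :: ('n, 'k) weyl) = 0 \<longleftrightarrow> c = 0"
  using weyl.scale_eq_0_iff[of c "1::('n, 'k) weyl"] assms by simp


section \<open>Commutators and ordered monomials\<close>

lemma commutator_mult: "commutator y (a * b) = commutator y a * b + a * commutator y b"
  by (simp add: commutator_def algebra_simps)

lemma commutator_zero: "commutator y 0 = 0"
  by (simp add: commutator_def)

lemma commutator_one: "commutator y (1::'a::{ring,monoid_mult}) = 0"
  by (simp add: commutator_def)

lemma commutator_sum: "commutator y (sum f M) = (\<Sum>i\<in>M. commutator y (f i))"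
  by (simp add: commutator_def sum_distrib_left sum_distrib_right sum_subtractf)

lemma commutator_weyl_const: "commutator y (weyl_const c * f) = weyl_const c * commutator y f"
  by (simp add: commutator_def right_diff_distrib weyl_const_left_commute mult.assoc)

text \<open>\<open>commutator y\<close> is a derivation with value \<open>1\<close> at
  \<open>g\<close>, hence differentiates powers of \<open>g\<close>. For \<open>k = 0\<close> the
  truncated exponent is harmless since the coefficient is \<open>0\<close>.\<close>

lemma commutator_power:
  fixes y g :: "('n, 'k::comm_ring_1) weyl"
  assumes "commutator y g = 1"
  shows "commutator y (g ^ k) = weyl_const (of_nat k) * g ^ (k - 1)"
proof (induction k)
  case 0
  show ?case
    by (simp add: commutator_one weyl_const_0)
next
  case (Suc k)
  have "g * (weyl_const (of_nat k) * g ^ (k - 1)) = weyl_const (of_nat k) * g ^ k"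
    by (cases k) (simp_all add: weyl_const_left_commute weyl_const_0)
  then show ?case
    using Suc assms
    by (simp add: commutator_mult weyl_const_add weyl_const_1 distrib_right)
qed

lemma commutator_power_0:
  fixes y g :: "'a::{ring,monoid_mult}"
  assumes "commutator y g = 0"
  shows "commutator y (g ^ k) = 0"
  by (induction k) (simp_all add: commutator_one commutator_mult assms)

text \<open>The list fixes the order of factors that may fail to commute. \<open>G\<close> is
  arbitrary because such monomials are formed both in the generators and in their images under
  \<open>\<phi>\<close>.\<close>

definition ordered_monomial :: "('g \<Rightarrow> 'a::monoid_mult) \<Rightarrow> 'g list \<Rightarrow> ('g \<Rightarrow> nat) \<Rightarrow> 'a" where
  "ordered_monomial G L \<gamma> = prod_list (map (\<lambda>g. G g ^ \<gamma> g) L)"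

lemma ordered_monomial_Nil [simp]: "ordered_monomial G [] \<gamma> = 1"
  by (simp add: ordered_monomial_def)

lemma ordered_monomial_Cons [simp]:
  "ordered_monomial G (g # L) \<gamma> = G g ^ \<gamma> g * ordered_monomial G L \<gamma>"
  by (simp add: ordered_monomial_def)

lemma ordered_monomial_append:
  "ordered_monomial G (L @ L') \<gamma> = ordered_monomial G L \<gamma> * ordered_monomial G L' \<gamma>"
  by (simp add: ordered_monomial_def)

lemma ordered_monomial_upd [simp]:
  "g \<notin> set L \<Longrightarrow> ordered_monomial G L (\<gamma>(g := k)) = ordered_monomial G L \<gamma>"
  unfolding ordered_monomial_def by (rule arg_cong[where f = prod_list]) auto

lemma ordered_monomial_zero: "(\<And>g. g \<in> set L \<Longrightarrow> \<gamma> g = 0) \<Longrightarrow> ordered_monomial G L \<gamma> = 1"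
  by (induction L) auto

lemma commutator_ordered_monomial_0:
  fixes G :: "'g \<Rightarrow> 'a::{ring,monoid_mult}"
  assumes "\<And>h. h \<in> set L \<Longrightarrow> commutator y (G h) = 0"
  shows "commutator y (ordered_monomial G L \<gamma>) = 0"
  using assms by (induction L) (simp_all add: commutator_one commutator_mult commutator_power_0)

text \<open>Here \<open>commutator y\<close> acts as the partial derivative in the variable
  \<open>g\<close>: by the Leibniz rule only the factor at \<open>g\<close> contributes, and it
  occurs once in \<open>L\<close>.\<close>

lemma commutator_ordered_monomial:
  fixes G :: "'g \<Rightarrow> ('n, 'k::comm_ring_1) weyl"
  assumes "distinct L" "g \<in> set L"
    and "\<And>h. h \<in> set L \<Longrightarrow> commutator y (G h) = (if h = g then 1 else 0)"
  shows "commutator y (ordered_monomial G L \<gamma>) =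
    weyl_const (of_nat (\<gamma> g)) * ordered_monomial G L (\<gamma>(g := \<gamma> g - 1))"
  using assms
proof (induction L)
  case (Cons h L)
  show ?case
  proof (cases "h = g")
    case True
    then have "commutator y (ordered_monomial G L \<gamma>) = 0"
      using Cons.prems by (intro commutator_ordered_monomial_0) auto
    then show ?thesis
      using True Cons.prems
      by (simp add: commutator_mult commutator_power mult.assoc fun_upd_same del: fun_upd_apply)
  next
    case False
    then have "commutator y (ordered_monomial G L \<gamma>) =
        weyl_const (of_nat (\<gamma> g)) * ordered_monomial G L (\<gamma>(g := \<gamma> g - 1))"
      using Cons.prems by (intro Cons.IH) auto
    moreover have "commutator y (ordered_monomial G (h # L) \<gamma>) =
        G h ^ \<gamma> h * commutator y (ordered_monomial G L \<gamma>)"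
      using False Cons.prems by (simp add: commutator_mult commutator_power_0)
    moreover have "(\<gamma>(g := \<gamma> g - 1)) h = \<gamma> h"
      using False by simp
    ultimately show ?thesis
      by (simp only: ordered_monomial_Cons weyl_const_left_commute)
  qed
qed simp

text \<open>The new factor commutes with every factor it has to pass on the way to its own
  power.\<close>

lemma mult_ordered_monomial:
  fixes G :: "'g \<Rightarrow> 'a::{ring,monoid_mult}"
  assumes "distinct L" "g \<in> set L" "\<And>h. h \<in> set L \<Longrightarrow> commutator (G g) (G h) = 0"
  shows "G g * ordered_monomial G L \<gamma> = ordered_monomial G L (\<gamma>(g := Suc (\<gamma> g)))"
  using assms
proof (induction L)
  case (Cons h L)
  show ?case
  proof (cases "h = g")
    case True
    then show ?thesis
      using Cons.prems by (simp add: mult.assoc fun_upd_same del: fun_upd_apply)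
  next
    case False
    have "commutator (G g) (G h ^ \<gamma> h) = 0"
      using Cons.prems by (simp add: commutator_power_0)
    then have "G g * G h ^ \<gamma> h = G h ^ \<gamma> h * G g"
      by (simp add: commutator_def)
    then have "G g * (G h ^ \<gamma> h * ordered_monomial G L \<gamma>) = G h ^ \<gamma> h * (G g * ordered_monomial G L \<gamma>)"
      by (metis mult.assoc)
    then show ?thesis
      using False Cons by simp
  qed
qed simp

text \<open>Stated with a sum on each side so that no truncated subtraction occurs.\<close>

lemma sum_fun_upd:
  fixes \<gamma> :: "'g::finite \<Rightarrow> nat"
  shows "sum (\<gamma>(g := k)) UNIV + \<gamma> g = sum \<gamma> UNIV + k"
  by (simp add: sum.remove[of UNIV g])

text \<open>Each \<open>commutator (Y g)\<close> differentiates a relation in the variable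
  \<open>g\<close> and lowers its degree. Induction on a degree bound kills all coefficients but the
  constant one, which then is the whole relation. Endomorphisms preserve \<open>comm\<close>, so the
  result also applies to images of the generators.\<close>

lemma ordered_monomials_independent:
  fixes G Y :: "'g::finite \<Rightarrow> ('n, 'k::field_char_0) weyl"
  assumes "distinct L" "set L = UNIV"
    and comm: "\<And>g h. commutator (Y g) (G h) = (if h = g then 1 else 0)"
    and one: "(1::('n, 'k) weyl) \<noteq> 0"
    and "finite M" "(\<Sum>\<gamma>\<in>M. weyl_const (c \<gamma>) * ordered_monomial G L \<gamma>) = 0" "\<gamma> \<in> M"
  shows "c \<gamma> = 0"
proof -
  \<comment> \<open>The bound is strict, so that \<open>d = 0\<close> forces \<open>M\<close> to be
    empty.\<close>
  have "\<forall>\<gamma>\<in>M. c \<gamma> = 0"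
    if "finite M" "\<forall>\<gamma>\<in>M. sum \<gamma> UNIV < d" "(\<Sum>\<gamma>\<in>M. weyl_const (c \<gamma>) * ordered_monomial G L \<gamma>) = 0"
    for M d c
    using that
  proof (induction d arbitrary: M c)
    case (Suc d)
    define lower where "lower = (\<lambda>g (\<gamma>::'g \<Rightarrow> nat). \<gamma>(g := \<gamma> g - 1))"
    have pos: "c \<gamma> = 0" if "\<gamma> \<in> M" "\<gamma> g > 0" for \<gamma> g
    proof -
      define N where "N = {\<gamma>\<in>M. \<gamma> g > 0}"
      \<comment> \<open>On \<open>N\<close> the exponent of \<open>g\<close> is positive, so the
        subtraction in \<open>lower\<close> does not truncate.\<close>
      have inj: "inj_on (lower g) N"
      proof (rule inj_onI)
        fix \<gamma> \<delta> :: "'g \<Rightarrow> nat"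
        assume "\<gamma> \<in> N" "\<delta> \<in> N" and eq: "lower g \<gamma> = lower g \<delta>"
        have "\<gamma> h = \<delta> h" for h
        proof -
          have "lower g \<gamma> h = lower g \<delta> h" "\<gamma> g > 0" "\<delta> g > 0"
            using eq \<open>\<gamma> \<in> N\<close> \<open>\<delta> \<in> N\<close> by (simp_all add: N_def)
          then show ?thesis
            by (cases "h = g") (auto simp: lower_def)
        qed
        then show "\<gamma> = \<delta>"
          by blast
      qed
      \<comment> \<open>\<open>e \<delta>\<close> is the coefficient of the lowered monomial in the
        differentiated relation, found by raising the exponent of \<open>g\<close> again.\<close>
      define e where "e = (\<lambda>\<delta>. c (\<delta>(g := Suc (\<delta> g))) * of_nat (Suc (\<delta> g)))"
      have e: "e (lower g \<gamma>) = c \<gamma> * of_nat (\<gamma> g)" if "\<gamma> \<in> N" for \<gamma>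
        using that by (simp add: e_def lower_def N_def del: of_nat_Suc)
      have deriv: "commutator (Y g) (ordered_monomial G L \<gamma>) =
          weyl_const (of_nat (\<gamma> g)) * ordered_monomial G L (lower g \<gamma>)" for \<gamma>
        unfolding lower_def using assms(1,2) comm by (intro commutator_ordered_monomial) auto
      have "0 = commutator (Y g) (\<Sum>\<gamma>\<in>M. weyl_const (c \<gamma>) * ordered_monomial G L \<gamma>)"
        by (simp only: Suc.prems(3) commutator_zero)
      also have "\<dots> = (\<Sum>\<gamma>\<in>M. weyl_const (c \<gamma> * of_nat (\<gamma> g)) * ordered_monomial G L (lower g \<gamma>))"
        by (simp add: commutator_sum commutator_weyl_const deriv)
      also have "\<dots> = (\<Sum>\<gamma>\<in>N. weyl_const (c \<gamma> * of_nat (\<gamma> g)) * ordered_monomial G L (lower g \<gamma>))"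
        using Suc.prems(1) by (intro sum.mono_neutral_right) (auto simp: N_def weyl_const_0)
      also have "\<dots> = (\<Sum>\<delta>\<in>lower g ` N. weyl_const (e \<delta>) * ordered_monomial G L \<delta>)"
        using inj by (simp add: sum.reindex e)
      finally have "(\<Sum>\<delta>\<in>lower g ` N. weyl_const (e \<delta>) * ordered_monomial G L \<delta>) = 0" ..
      moreover have "sum \<delta> UNIV < d" if \<delta>: "\<delta> \<in> lower g ` N" for \<delta>
      proof -
        obtain \<gamma> where \<gamma>: "\<gamma> \<in> N" "\<delta> = lower g \<gamma>"
          using \<delta> by blast
        then show ?thesis
          using Suc.prems(2) sum_fun_upd[of \<gamma> g "\<gamma> g - 1"] by (fastforce simp: lower_def N_def)
      qed
      moreover have "finite (lower g ` N)"
        using Suc.prems(1) by (simp add: N_def)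
      ultimately have "\<forall>\<delta>\<in>lower g ` N. e \<delta> = 0"
        using Suc.IH by blast
      moreover have "\<gamma> \<in> N"
        using that by (simp add: N_def)
      ultimately have "c \<gamma> * of_nat (\<gamma> g) = 0"
        using e by fastforce
      \<comment> \<open>Characteristic zero enters here: \<open>of_nat (\<gamma> g)\<close> is
        nonzero because \<open>\<gamma> g > 0\<close>.\<close>
      then show ?thesis
        using that by simp
    qed
    have "c \<gamma> = 0" if "\<gamma> \<in> M" for \<gamma>
    proof (cases "\<gamma> = (\<lambda>_. 0)")
      case True
      \<comment> \<open>Every other exponent function is positive somewhere, so its coefficient
        vanishes by \<open>pos\<close> and only the constant term is left.\<close>
      have "0 = (\<Sum>\<delta>\<in>{\<gamma>}. weyl_const (c \<delta>) * ordered_monomial G L \<delta>)"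
        unfolding Suc.prems(3)[symmetric]
      proof (intro sum.mono_neutral_right ballI)
        fix \<delta> assume "\<delta> \<in> M - {\<gamma>}"
        then obtain g where "\<delta> g > 0" "\<delta> \<in> M"
          using True by fastforce
        then show "weyl_const (c \<delta>) * ordered_monomial G L \<delta> = 0"
          using pos by (simp add: weyl_const_0)
      qed (use that Suc.prems(1) in auto)
      then have "weyl_const (c \<gamma>) = (0::('n, 'k) weyl)"
        using True by (simp add: ordered_monomial_zero)
      then show ?thesis
        using weyl_const_eq_0_iff[OF one] by simp
    next
      case False
      then show ?thesis
        using pos that by fastforce
    qed
    then show ?case
      by blast
  qed simp
  moreover have "\<forall>\<gamma>\<in>M. sum \<gamma> UNIV < Suc (\<Sum>\<gamma>\<in>M. sum \<gamma> UNIV)"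
    using \<open>finite M\<close> member_le_sum[of _ M "\<lambda>\<gamma>. sum \<gamma> UNIV"] by (simp add: less_Suc_eq_le)
  ultimately show ?thesis
    using assms(5-7) by blast
qed

section \<open>The degree filtration\<close>

lemma UNIV_weyl_gen: "(UNIV :: 'n weyl_gen set) = range GenX \<union> range GenD"
proof (rule UNIV_eq_I)
  show "g \<in> range GenX \<union> range GenD" for g :: "'n weyl_gen"
    by (cases g) auto
qed

instance weyl_gen :: (finite) finite
  by standard (simp add: UNIV_weyl_gen)

lemma sum_weyl_gen:
  fixes \<gamma> :: "'n::finite weyl_gen \<Rightarrow> nat"
  shows "sum \<gamma> UNIV = (\<Sum>i\<in>UNIV. \<gamma> (GenX i)) + (\<Sum>i\<in>UNIV. \<gamma> (GenD i))"
proof -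
  have "sum \<gamma> UNIV = sum \<gamma> (range GenX) + sum \<gamma> (range GenD)"
    unfolding UNIV_weyl_gen by (intro sum.union_disjoint) auto
  then show ?thesis
    by (simp add: sum.reindex inj_def)
qed

lemma card_weyl_gen: "CARD('n::finite weyl_gen) = 2 * CARD('n)"
  using sum_weyl_gen[of "\<lambda>_::'n weyl_gen. 1"] by simp

primrec weyl_gen_value :: "'n weyl_gen \<Rightarrow> ('n, 'k::comm_ring_1) weyl" where
  "weyl_gen_value (GenX i) = weyl_x i"
| "weyl_gen_value (GenD i) = weyl_d i"

text \<open>The dual of \<open>g\<close> has commutator \<open>1\<close> with the generator
  \<open>g\<close> and \<open>0\<close> with all others; the sign accounts for the antisymmetry of
  the commutator.\<close>

primrec weyl_gen_dual :: "'n weyl_gen \<Rightarrow> ('n, 'k::comm_ring_1) weyl" where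
  "weyl_gen_dual (GenX i) = weyl_d i"
| "weyl_gen_dual (GenD i) = - weyl_x i"

lemma commutator_weyl_x_x: "commutator (weyl_x i) (weyl_x j) = 0"
  unfolding commutator_def
  by transfer (auto simp: weyl_cong_def weyl_relations_def commutator_def intro!: two_sided_ideal.incl)

lemma commutator_weyl_d_d: "commutator (weyl_d i) (weyl_d j) = 0"
  unfolding commutator_def
  by transfer (auto simp: weyl_cong_def weyl_relations_def commutator_def intro!: two_sided_ideal.incl)

lemma commutator_weyl_d_x: "commutator (weyl_d i) (weyl_x j) = (if i = j then 1 else 0)"
proof -
  have "weyl_d i * weyl_x j - weyl_x j * weyl_d i - (if i = j then 1 else 0) = 0"
  proof (cases "i = j")
    case True
    then show ?thesis
      by (simp, transfer)
        (auto simp: weyl_cong_def weyl_relations_def commutator_def intro!: two_sided_ideal.incl)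
  next
    case False
    then show ?thesis
      by (simp, transfer)
        (auto simp: weyl_cong_def weyl_relations_def commutator_def intro!: two_sided_ideal.incl)
  qed
  then show ?thesis
    by (simp add: commutator_def)
qed

lemma commutator_weyl_gen_dual_value:
  "commutator (weyl_gen_dual g) (weyl_gen_value h) = (if h = g then 1 else 0)"
proof -
  have "commutator (- weyl_x i) b = commutator b (weyl_x i)" for i and b :: "('a, 'b) weyl"
    by (simp add: commutator_def)
  then show ?thesis
    by (cases g; cases h)
      (auto simp: commutator_weyl_x_x commutator_weyl_d_d commutator_weyl_d_x)
qed

definition weyl_gens :: "'n::{finite,linorder} weyl_gen list" where
  "weyl_gens = map GenX (sorted_list_of_set UNIV) @ map GenD (sorted_list_of_set UNIV)"

lemma distinct_weyl_gens: "distinct weyl_gens"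
  by (auto simp: weyl_gens_def distinct_map inj_on_def)

lemma set_weyl_gens: "set weyl_gens = UNIV"
  by (simp add: weyl_gens_def UNIV_weyl_gen)

text \<open>One exponent function on all generators replaces the pair
  \<open>(\<alpha>, \<beta>)\<close>, so that both kinds of generators are treated alike and the
  degree is a single sum.\<close>

definition weyl_pbw :: "('n::{finite,linorder} weyl_gen \<Rightarrow> nat) \<Rightarrow> ('n, 'k::comm_ring_1) weyl" where
  "weyl_pbw = ordered_monomial weyl_gen_value weyl_gens"

lemma weyl_pbw_zero: "weyl_pbw (\<lambda>_. 0) = 1"
  by (simp add: weyl_pbw_def ordered_monomial_zero)

lemma weyl_monomial_eq_pbw: "weyl_monomial (\<alpha>, \<beta>) = weyl_pbw (case_weyl_gen \<alpha> \<beta>)"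
  by (simp add: weyl_monomial_def weyl_pbw_def weyl_gens_def ordered_monomial_def comp_def)

lemma monomial_degree_eq_sum: "monomial_degree (\<alpha>, \<beta>) = sum (case_weyl_gen \<alpha> \<beta>) UNIV"
  by (simp add: monomial_degree_def sum_weyl_gen)

text \<open>A generator \<open>weyl_x i\<close> slips into place among the commuting powers. A
  generator \<open>weyl_d i\<close> first crosses the whole block of \<open>weyl_x\<close> powers,
  which costs the derivative in \<open>weyl_x i\<close>, a term of lower degree.\<close>

lemma weyl_gen_value_mult_pbw:
  "weyl_gen_value g * (weyl_pbw \<gamma> :: ('n::{finite,linorder}, 'k::comm_ring_1) weyl) =
    weyl_pbw (\<gamma>(g := Suc (\<gamma> g))) +
    (case g of GenX i \<Rightarrow> 0
      | GenD i \<Rightarrow> weyl_const (of_nat (\<gamma> (GenX i))) * weyl_pbw (\<gamma>(GenX i := \<gamma> (GenX i) - 1)))"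
proof -
  define X D :: "'n weyl_gen list"
    where "X = map GenX (sorted_list_of_set UNIV)" and "D = map GenD (sorted_list_of_set UNIV)"
  let ?G = "weyl_gen_value :: _ \<Rightarrow> ('n, 'k) weyl"
  have pbw: "weyl_pbw \<gamma> = ordered_monomial ?G X \<gamma> * ordered_monomial ?G D \<gamma>" for \<gamma>
    by (simp add: weyl_pbw_def weyl_gens_def X_def D_def ordered_monomial_append)
  have dist: "distinct X" "distinct D"
    by (simp_all add: X_def D_def distinct_map inj_on_def)
  show ?thesis
  proof (cases g)
    case (GenX i)
    have "?G g * ordered_monomial ?G X \<gamma> = ordered_monomial ?G X (\<gamma>(g := Suc (\<gamma> g)))"
      using dist GenX by (intro mult_ordered_monomial) (auto simp: X_def commutator_weyl_x_x)
    moreover have "g \<notin> set D"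
      using GenX by (auto simp: D_def)
    ultimately show ?thesis
      using GenX by (simp add: pbw mult.assoc[symmetric] del: fun_upd_apply)
  next
    case (GenD i)
    have "?G g * ordered_monomial ?G D \<gamma> = ordered_monomial ?G D (\<gamma>(g := Suc (\<gamma> g)))"
      using dist GenD by (intro mult_ordered_monomial) (auto simp: D_def commutator_weyl_d_d)
    moreover have "commutator (?G g) (ordered_monomial ?G X \<gamma>) =
        weyl_const (of_nat (\<gamma> (GenX i))) * ordered_monomial ?G X (\<gamma>(GenX i := \<gamma> (GenX i) - 1))"
      using dist GenD
      by (intro commutator_ordered_monomial) (auto simp: X_def commutator_weyl_d_x split: if_splits)
    then have "?G g * ordered_monomial ?G X \<gamma> = ordered_monomial ?G X \<gamma> * ?G g +
        weyl_const (of_nat (\<gamma> (GenX i))) * ordered_monomial ?G X (\<gamma>(GenX i := \<gamma> (GenX i) - 1))"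
      by (simp add: commutator_def algebra_simps del: fun_upd_apply)
    then have "?G g * weyl_pbw \<gamma> = ordered_monomial ?G X \<gamma> * (?G g * ordered_monomial ?G D \<gamma>) +
        weyl_const (of_nat (\<gamma> (GenX i))) *
          (ordered_monomial ?G X (\<gamma>(GenX i := \<gamma> (GenX i) - 1)) * ordered_monomial ?G D \<gamma>)"
      by (simp only: pbw mult.assoc[symmetric] distrib_right)
    moreover have "g \<notin> set X" "GenX i \<notin> set D"
      using GenD by (auto simp: X_def D_def)
    ultimately show ?thesis
      using GenD by (simp add: pbw del: fun_upd_apply)
  qed
qed

section \<open>The filtration by total degree\<close>

definition weyl_filtration :: "nat \<Rightarrow> ('n::{finite,linorder}, 'k::field) weyl set" where
  "weyl_filtration N = weyl.span (weyl_pbw ` {\<gamma>. sum \<gamma> UNIV \<le> N})"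

lemma weyl_filtration_mono: "M \<le> N \<Longrightarrow> weyl_filtration M \<subseteq> weyl_filtration N"
  unfolding weyl_filtration_def by (intro weyl.span_mono) auto

lemma weyl_pbw_mem_filtration: "sum \<gamma> UNIV \<le> N \<Longrightarrow> weyl_pbw \<gamma> \<in> weyl_filtration N"
  unfolding weyl_filtration_def by (intro weyl.span_base) auto

lemma one_mem_weyl_filtration: "1 \<in> weyl_filtration N"
  using weyl_pbw_mem_filtration[of "\<lambda>_. 0" N] by (simp add: weyl_pbw_zero)

lemma weyl_filtration_zero: "0 \<in> weyl_filtration N"
  and weyl_filtration_add: "f \<in> weyl_filtration N \<Longrightarrow> g \<in> weyl_filtration N \<Longrightarrow> f + g \<in> weyl_filtration N"
  and weyl_filtration_scale: "f \<in> weyl_filtration N \<Longrightarrow> weyl_const c * f \<in> weyl_filtration N"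
  and weyl_filtration_sum: "(\<And>i. i \<in> I \<Longrightarrow> h i \<in> weyl_filtration N) \<Longrightarrow> sum h I \<in> weyl_filtration N"
  unfolding weyl_filtration_def
  by (auto intro: weyl.span_zero weyl.span_add weyl.span_scale weyl.span_sum)

lemma weyl_filtration_induct [consumes 1, case_names zero add scale base]:
  assumes "f \<in> weyl_filtration N"
    and "P 0" "\<And>f g. P f \<Longrightarrow> P g \<Longrightarrow> P (f + g)" "\<And>c f. P f \<Longrightarrow> P (weyl_const c * f)"
    and "\<And>\<gamma>. sum \<gamma> UNIV \<le> N \<Longrightarrow> P (weyl_pbw \<gamma>)"
  shows "P f"
  using assms(1) unfolding weyl_filtration_def
proof (induction rule: weyl.span_induct)
  case base
  show ?case
    unfolding weyl.subspace_def using assms(2-4) by auto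
next
  case (step f)
  then show ?case
    using assms(5) by auto
qed

lemma weyl_gen_value_mult_filtration:
  assumes "f \<in> weyl_filtration N"
  shows "weyl_gen_value g * f \<in> weyl_filtration (Suc N)"
  using assms
proof (induction rule: weyl_filtration_induct)
  case (base \<gamma>)
  have "sum (\<gamma>(g := Suc (\<gamma> g))) UNIV \<le> Suc N"
    using base sum_fun_upd[of \<gamma> g "Suc (\<gamma> g)"] by linarith
  moreover have "sum (\<gamma>(h := \<gamma> h - 1)) UNIV \<le> Suc N" for h
    using base sum_fun_upd[of \<gamma> h "\<gamma> h - 1"] by linarith
  ultimately show ?case
    unfolding weyl_gen_value_mult_pbw
    by (auto split: weyl_gen.split
        intro!: weyl_filtration_add weyl_filtration_zero weyl_filtration_scale weyl_pbw_mem_filtration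
        simp del: fun_upd_apply)
qed (auto simp: distrib_left weyl_const_left_commute
    intro: weyl_filtration_zero weyl_filtration_add weyl_filtration_scale)

lemma weyl_gen_value_power_mult_filtration:
  "f \<in> weyl_filtration N \<Longrightarrow> weyl_gen_value g ^ k * f \<in> weyl_filtration (k + N)"
  by (induction k) (auto simp: mult.assoc intro: weyl_gen_value_mult_filtration)

text \<open>By linearity the left factor is a monomial. Its powers are applied to \<open>h\<close>
  one after the other, and each generator raises the index by one.\<close>

lemma weyl_filtration_mult:
  assumes "f \<in> weyl_filtration M" "h \<in> weyl_filtration N"
  shows "f * h \<in> weyl_filtration (M + N)"
  using assms(1)
proof (induction rule: weyl_filtration_induct)
  case (base \<gamma>)
  have "ordered_monomial weyl_gen_value L \<gamma> * h \<in> weyl_filtration (sum_list (map \<gamma> L) + N)" for L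
    by (induction L)
      (use assms(2) in \<open>auto simp: mult.assoc add.assoc intro: weyl_gen_value_power_mult_filtration\<close>)
  from this[of weyl_gens] have "weyl_pbw \<gamma> * h \<in> weyl_filtration (sum \<gamma> UNIV + N)"
    by (simp add: weyl_pbw_def sum_list_distinct_conv_sum_set distinct_weyl_gens set_weyl_gens)
  then show ?case
    using base weyl_filtration_mono[of "sum \<gamma> UNIV + N" "M + N"] by auto
qed (auto simp: distrib_right mult.assoc
    intro: weyl_filtration_zero weyl_filtration_add weyl_filtration_scale)

lemma weyl_filtration_power:
  "f \<in> weyl_filtration M \<Longrightarrow> f ^ k \<in> weyl_filtration (M * k)"
  by (induction k) (auto intro: one_mem_weyl_filtration weyl_filtration_mult)

lemma ordered_monomial_mem_filtration:
  assumes "\<And>g. G g \<in> weyl_filtration M"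
  shows "ordered_monomial G L \<gamma> \<in> weyl_filtration (M * sum_list (map \<gamma> L))"
  by (induction L)
    (use assms in \<open>auto simp: distrib_left intro: one_mem_weyl_filtration weyl_filtration_mult weyl_filtration_power\<close>)

text \<open>The spanning half of the basis theorem: a word of length \<open>l\<close> lies in
  \<open>weyl_filtration l\<close>, since each letter acts by left multiplication, and words span
  the free algebra.\<close>

lemma weyl_filtration_exhaust:
  fixes f :: "('n::{finite,linorder}, 'k::field) weyl"
  shows "\<exists>N. f \<in> weyl_filtration N"
proof (induction f rule: weyl.abs_induct)
  case (1 p)
  show ?case
  proof (induction p rule: poly_mapping_single_add_induct)
    case zero
    then show ?case
      by (metis weyl_filtration_zero zero_weyl.abs_eq)
  next
    case (add p q)
    then obtain M N where "abs_weyl p \<in> weyl_filtration M" "abs_weyl q \<in> weyl_filtration N"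
      by blast
    then have "abs_weyl p + abs_weyl q \<in> weyl_filtration (max M N)"
      using weyl_filtration_mono[of M "max M N"] weyl_filtration_mono[of N "max M N"]
      by (intro weyl_filtration_add) auto
    then show ?case
      by (metis plus_weyl.abs_eq)
  next
    case (single w a)
    have "abs_weyl (Poly_Mapping.single (Word gs) a) \<in> weyl_filtration (length gs)" for gs :: "'n weyl_gen list"
    proof (induction gs)
      case Nil
      have "abs_weyl (Poly_Mapping.single (Word ([] :: 'n weyl_gen list)) a) = weyl_const a * 1"
        by (simp add: weyl_const.abs_eq free_const_def zero_free_monoid_def)
      then show ?case
        by (simp only: one_mem_weyl_filtration weyl_filtration_scale)
    next
      case (Cons g gs)
      have "abs_weyl (free_gen g) = (weyl_gen_value g :: ('n, 'k) weyl)"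
        by (cases g) (simp_all add: weyl_x.abs_eq weyl_d.abs_eq)
      moreover have "Poly_Mapping.single (Word (g # gs)) a = free_gen g * Poly_Mapping.single (Word gs) a"
        by (simp add: free_gen_def mult_single plus_free_monoid_def)
      ultimately have "abs_weyl (Poly_Mapping.single (Word (g # gs)) a) =
          weyl_gen_value g * abs_weyl (Poly_Mapping.single (Word gs) a)"
        by (simp flip: times_weyl.abs_eq)
      then show ?case
        using Cons weyl_gen_value_mult_filtration by simp
    qed
    then show ?case
      by (metis free_monoid.exhaust)
  qed
qed

section \<open>The basis theorem and the degree\<close>

lemma weyl_pbw_independent:
  assumes "(1::('n::{finite,linorder}, 'k::field_char_0) weyl) \<noteq> 0" "finite M"
    and "(\<Sum>\<gamma>\<in>M. weyl_const (c \<gamma>) * weyl_pbw \<gamma>) = (0::('n, 'k) weyl)" "\<gamma> \<in> M"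
  shows "c \<gamma> = 0"
  using ordered_monomials_independent[OF distinct_weyl_gens set_weyl_gens
      commutator_weyl_gen_dual_value assms(1,2) assms(3)[unfolded weyl_pbw_def] assms(4)] .

lemma weyl_monomials_independent:
  assumes "(1::('n::{finite,linorder}, 'k::field_char_0) weyl) \<noteq> 0" "finite M"
    and "(\<Sum>m\<in>M. weyl_const (c m) * weyl_monomial m) = (0::('n, 'k) weyl)" "m \<in> M"
  shows "c m = 0"
proof -
  let ?e = "\<lambda>m :: ('n \<Rightarrow> nat) \<times> ('n \<Rightarrow> nat). case_weyl_gen (fst m) (snd m)"
  have "(fst m, snd m) = (fst m', snd m')" if "?e m = ?e m'" for m m'
    using fun_cong[OF that, of "GenX _"] fun_cong[OF that, of "GenD _"]
    by (intro prod_eqI ext) simp_all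
  then have inj: "inj_on ?e M"
    by (intro inj_onI) simp
  then have inv: "inv_into M ?e (?e m) = m" if "m \<in> M" for m
    using that by (rule inv_into_f_f)
  have "(\<Sum>\<gamma>\<in>?e ` M. weyl_const (c (inv_into M ?e \<gamma>)) * (weyl_pbw \<gamma> :: ('n, 'k) weyl)) =
      (\<Sum>m\<in>M. weyl_const (c m) * weyl_monomial m)"
    unfolding sum.reindex[OF inj] comp_def
    by (intro sum.cong refl) (simp add: inv flip: weyl_monomial_eq_pbw)
  then have "c (inv_into M ?e (?e m)) = 0"
    using assms by (intro weyl_pbw_independent[where M = "?e ` M" and c = "\<lambda>\<gamma>. c (inv_into M ?e \<gamma>)"]) auto
  then show ?thesis
    using inv assms(4) by simp
qed

text \<open>The expansion runs over indices rather than vectors: \<open>T\<close> picks one index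
  for each vector used, so \<open>v\<close> is injective on it.\<close>

lemma (in vector_space) span_image_expansion:
  assumes "x \<in> span (v ` B)"
  obtains T c where "finite T" "T \<subseteq> B" "x = (\<Sum>i\<in>T. scale (c i) (v i))"
proof -
  obtain t r where t: "finite t" "t \<subseteq> v ` B" "x = (\<Sum>a\<in>t. scale (r a) a)"
    using assms unfolding span_explicit by (elim CollectE exE conjE) (rule that; assumption)
  from t(2) obtain T where T: "T \<subseteq> B" "inj_on v T" "t = v ` T"
    unfolding subset_image_inj by (elim exE conjE) (rule that; assumption)
  have "x = (\<Sum>i\<in>T. scale (r (v i)) (v i))"
    unfolding t(3) T(3) by (simp add: sum.reindex[OF T(2)])
  moreover have "finite T"
    using t(1) T(2) unfolding T(3) by (rule finite_imageD)
  ultimately show ?thesis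
    using that T(1) by metis
qed

lemma weyl_pbw_expansion:
  fixes f :: "('n::{finite,linorder}, 'k::field) weyl"
  obtains M c where "finite M" "f = (\<Sum>\<gamma>\<in>M. weyl_const (c \<gamma>) * weyl_pbw \<gamma>)"
proof -
  obtain N where "f \<in> weyl_filtration N"
    using weyl_filtration_exhaust by blast
  then show ?thesis
    unfolding weyl_filtration_def using that by (rule weyl.span_image_expansion)
qed

lemma weyl_monomial_expansion:
  fixes f :: "('n::{finite,linorder}, 'k::field) weyl"
  obtains c where "f = (\<Sum>m\<in>Poly_Mapping.keys c. weyl_const (Poly_Mapping.lookup c m) * weyl_monomial m)"
proof -
  obtain M d where M: "finite M" "f = (\<Sum>\<gamma>\<in>M. weyl_const (d \<gamma>) * weyl_pbw \<gamma>)"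
    by (rule weyl_pbw_expansion)
  define e :: "('n weyl_gen \<Rightarrow> nat) \<Rightarrow> ('n \<Rightarrow> nat) \<times> ('n \<Rightarrow> nat)"
    where "e = (\<lambda>\<gamma>. (\<lambda>i. \<gamma> (GenX i), \<lambda>i. \<gamma> (GenD i)))"
  have e: "case_weyl_gen (fst (e \<gamma>)) (snd (e \<gamma>)) = \<gamma>" for \<gamma>
    by (auto simp: e_def split: weyl_gen.split)
  then have inj: "inj_on e M"
    by (metis inj_onI)
  have e_pbw: "weyl_monomial (e \<gamma>) = (weyl_pbw \<gamma> :: ('n, 'k) weyl)" for \<gamma>
    using weyl_monomial_eq_pbw[of "fst (e \<gamma>)" "snd (e \<gamma>)"] by (simp add: e)
  \<comment> \<open>Indices at which \<open>d\<close> vanishes drop out of \<open>keys c\<close>,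
    hence the change of index set in the last sum below.\<close>
  define c where "c = Poly_Mapping.Abs_poly_mapping
    (\<lambda>m. if m \<in> e ` M then d (case_weyl_gen (fst m) (snd m)) else 0)"
  have c: "Poly_Mapping.lookup c m = (if m \<in> e ` M then d (case_weyl_gen (fst m) (snd m)) else 0)" for m
    unfolding c_def using \<open>finite M\<close> by (subst Abs_poly_mapping_inverse) auto
  have "f = (\<Sum>m\<in>e ` M. weyl_const (Poly_Mapping.lookup c m) * weyl_monomial m)"
    unfolding M(2) sum.reindex[OF inj] by (intro sum.cong) (auto simp: c e e_pbw)
  also have "\<dots> = (\<Sum>m\<in>Poly_Mapping.keys c. weyl_const (Poly_Mapping.lookup c m) * weyl_monomial m)"
    using \<open>finite M\<close>
    by (intro sum.mono_neutral_right) (auto simp: c in_keys_iff weyl_const_0 split: if_splits)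
  finally show ?thesis
    using that by blast
qed

text \<open>This justifies the \<open>THE\<close> in \<open>weyl_coeffs\<close>. Uniqueness follows
  from independence, applied to the difference of two expansions over the union of their
  supports.\<close>

lemma weyl_coeffs_expansion:
  fixes f :: "('n::{finite,linorder}, 'k::field_char_0) weyl"
  assumes "(1::('n, 'k) weyl) \<noteq> 0"
  shows "f = (\<Sum>m\<in>Poly_Mapping.keys (weyl_coeffs f).
    weyl_const (Poly_Mapping.lookup (weyl_coeffs f) m) * weyl_monomial m)"
proof -
  let ?ev = "\<lambda>c. \<Sum>m\<in>Poly_Mapping.keys c. weyl_const (Poly_Mapping.lookup c m) * (weyl_monomial m :: ('n, 'k) weyl)"
  obtain c where c: "f = ?ev c"
    by (rule weyl_monomial_expansion)
  moreover have "c' = c" if c': "f = ?ev c'" for c'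
  proof (rule poly_mapping_eqI)
    fix m
    define M where "M = Poly_Mapping.keys c \<union> Poly_Mapping.keys c'"
    have ev: "?ev d = (\<Sum>m\<in>M. weyl_const (Poly_Mapping.lookup d m) * weyl_monomial m)"
      if "Poly_Mapping.keys d \<subseteq> M" for d
      using that by (intro sum.mono_neutral_left) (auto simp: M_def in_keys_iff weyl_const_0)
    have "(\<Sum>m\<in>M. weyl_const (Poly_Mapping.lookup c' m - Poly_Mapping.lookup c m) * weyl_monomial m) = ?ev c' - ?ev c"
      using ev[of c] ev[of c'] by (simp add: M_def weyl.scale_left_diff_distrib sum_subtractf)
    also have "\<dots> = 0"
      using c c' by simp
    finally have "Poly_Mapping.lookup c' m - Poly_Mapping.lookup c m = 0" if "m \<in> M"
      using weyl_monomials_independent[OF assms, of M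
          "\<lambda>m. Poly_Mapping.lookup c' m - Poly_Mapping.lookup c m" m] that
      by (simp add: M_def)
    then show "Poly_Mapping.lookup c' m = Poly_Mapping.lookup c m"
      by (cases "m \<in> M") (auto simp: M_def in_keys_iff)
  qed
  ultimately show ?thesis
    unfolding weyl_coeffs_def by (rule theI)
qed

text \<open>Converts degree bounds into membership in the filtration, the form in which products and
  images are estimated. Zero is treated apart since its degree is a convention.\<close>

lemma mem_weyl_filtration_degree:
  fixes f :: "('n::{finite,linorder}, 'k::field_char_0) weyl"
  assumes "(1::('n, 'k) weyl) \<noteq> 0"
  shows "f \<in> weyl_filtration (weyl_degree f)"
proof (cases "f = 0")
  case False
  have "weyl_monomial m \<in> (weyl_filtration (weyl_degree f) :: ('n, 'k) weyl set)"
    if "m \<in> Poly_Mapping.keys (weyl_coeffs f)" for m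
  proof -
    have "monomial_degree m \<le> weyl_degree f"
      using that False by (auto simp: weyl_degree_def intro!: Max_ge)
    then show ?thesis
      by (cases m) (simp add: weyl_monomial_eq_pbw monomial_degree_eq_sum weyl_pbw_mem_filtration)
  qed
  then show ?thesis
    by (subst weyl_coeffs_expansion[OF assms]) (intro weyl_filtration_sum weyl_filtration_scale)
qed (simp add: weyl_filtration_zero)

section \<open>Counting\<close>

text \<open>Stars and bars: the slack \<open>N - sum \<gamma> UNIV\<close> becomes an extra head
  entry, which turns the inequality into an equation.\<close>

lemma bij_betw_bounded_sum_lists:
  assumes "distinct L" "set L = (UNIV :: 'g::finite set)"
  shows "bij_betw (\<lambda>\<gamma>. (N - sum \<gamma> UNIV) # map \<gamma> L) {\<gamma> :: 'g \<Rightarrow> nat. sum \<gamma> UNIV \<le> N}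
    {l. length l = Suc (CARD('g)) \<and> sum_list l = N}"
proof (rule bij_betw_imageI)
  have len: "length L = CARD('g)"
    using assms distinct_card by fastforce
  have sum: "sum_list (map \<gamma> L) = sum \<gamma> UNIV" for \<gamma> :: "'g \<Rightarrow> nat"
    using assms by (simp add: sum_list_distinct_conv_sum_set)
  show "inj_on (\<lambda>\<gamma>. (N - sum \<gamma> UNIV) # map \<gamma> L) {\<gamma> :: 'g \<Rightarrow> nat. sum \<gamma> UNIV \<le> N}"
    using assms(2) by (intro inj_onI ext) auto
  show "(\<lambda>\<gamma>. (N - sum \<gamma> UNIV) # map \<gamma> L) ` {\<gamma> :: 'g \<Rightarrow> nat. sum \<gamma> UNIV \<le> N} =
      {l. length l = Suc (CARD('g)) \<and> sum_list l = N}"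
  proof (intro equalityI subsetI)
    fix l assume l: "l \<in> {l :: nat list. length l = Suc (CARD('g)) \<and> sum_list l = N}"
    then obtain a k where k: "l = a # k" "length k = length L"
      by (cases l) (auto simp: len)
    \<comment> \<open>The preimage reads its values off the tail \<open>k\<close>, position by
      position along \<open>L\<close>.\<close>
    define \<gamma> where "\<gamma> = (\<lambda>g. the (map_of (zip L k) g))"
    have "map \<gamma> L = k"
      using k(2) assms(1) by (intro nth_equalityI) (simp_all add: \<gamma>_def map_of_zip_nth)
    moreover from this have "sum \<gamma> UNIV + a = N"
      using l k(1) sum[of \<gamma>] by simp
    ultimately show "l \<in> (\<lambda>\<gamma>. (N - sum \<gamma> UNIV) # map \<gamma> L) ` {\<gamma> :: 'g \<Rightarrow> nat. sum \<gamma> UNIV \<le> N}"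
      using k(1) by (intro image_eqI[of _ _ \<gamma>]) auto
  qed (auto simp: len sum)
qed

lemma card_bounded_sum:
  "card {\<gamma> :: 'g::finite \<Rightarrow> nat. sum \<gamma> UNIV \<le> N} = (N + CARD('g)) choose CARD('g)"
proof -
  obtain L :: "'g list" where L: "set L = UNIV" "distinct L"
    using finite_distinct_list[of "UNIV :: 'g set"] by auto
  have "card {\<gamma> :: 'g \<Rightarrow> nat. sum \<gamma> UNIV \<le> N} =
      card {l :: nat list. length l = Suc (CARD('g)) \<and> sum_list l = N}"
    by (rule bij_betw_same_card[OF bij_betw_bounded_sum_lists[OF L(2,1)]])
  also have "\<dots> = (N + CARD('g)) choose N"
    by (simp add: card_length_sum_list)
  also have "\<dots> = (N + CARD('g)) choose CARD('g)"
    using binomial_symmetric[of N "N + CARD('g)"] by simp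
  finally show ?thesis .
qed

text \<open>The cardinality is positive, whereas an infinite set has cardinality
  \<open>0\<close>.\<close>

lemma finite_bounded_sum: "finite {\<gamma> :: 'g::finite \<Rightarrow> nat. sum \<gamma> UNIV \<le> N}"
  using card_bounded_sum[of N, where 'g = 'g] by (intro card_ge_0_finite) simp

text \<open>Up to the factorial the binomial coefficient is the product of \<open>N + 1\<close> up
  to \<open>N + r\<close>, whose \<open>r\<close> factors lie between \<open>N\<close> and
  \<open>N + r\<close>.\<close>

lemma fact_times_binomial_bounds:
  fixes N r :: nat
  shows "real N ^ r \<le> fact r * real ((N + r) choose r)"
    and "fact r * real ((N + r) choose r) \<le> real (N + r) ^ r"
proof -
  have "fact r * real ((N + r) choose r) = pochhammer (real N + 1) r"
    by (simp add: binomial_gbinomial gbinomial_pochhammer')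
  also have "\<dots> = (\<Prod>i=0..<r. real N + 1 + real i)"
    by (simp add: pochhammer_prod)
  finally have eq: "fact r * real ((N + r) choose r) = (\<Prod>i=0..<r. real N + 1 + real i)" .
  have "(\<Prod>i=0..<r. real N) \<le> (\<Prod>i=0..<r. real N + 1 + real i)"
    by (intro prod_mono) auto
  then show "real N ^ r \<le> fact r * real ((N + r) choose r)"
    by (simp add: eq)
  have "(\<Prod>i=0..<r. real N + 1 + real i) \<le> (\<Prod>i=0..<r. real (N + r))"
    by (intro prod_mono) auto
  then show "fact r * real ((N + r) choose r) \<le> real (N + r) ^ r"
    by (simp add: eq)
qed

text \<open>Dividing by \<open>N ^ r\<close> and letting \<open>N\<close> tend to infinity compares
  the leading coefficients, which are \<open>m\<close> and \<open>D ^ r\<close> up to the common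
  factor \<open>1 / fact r\<close>.\<close>

lemma le_power_of_binomial_growth:
  fixes m D c r :: nat
  assumes "\<And>N. m * ((N + r) choose r) \<le> (D * N + c + r) choose r"
  shows "m \<le> D ^ r"
proof -
  have "real m \<le> (real D + real (c + r) / real N) ^ r" if "N > 0" for N
  proof -
    have "real m * real N ^ r \<le> real m * (fact r * real ((N + r) choose r))"
      by (intro mult_left_mono fact_times_binomial_bounds) simp
    also have "\<dots> = fact r * real (m * ((N + r) choose r))"
      by simp
    also have "\<dots> \<le> fact r * real ((D * N + c + r) choose r)"
      by (intro mult_left_mono of_nat_mono assms) simp
    also have "\<dots> \<le> real (D * N + c + r) ^ r"
      by (rule fact_times_binomial_bounds)
    also have "real (D * N + c + r) = (real D + real (c + r) / real N) * real N"
      using that by (simp add: field_simps)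
    finally show ?thesis
      using that by (simp add: power_mult_distrib)
  qed
  then have "eventually (\<lambda>N. real m \<le> (real D + real (c + r) / real N) ^ r) sequentially"
    by (intro eventually_mono[OF eventually_gt_at_top[of 0]])
  moreover have "(\<lambda>N. (real D + real (c + r) / real N) ^ r) \<longlonglongrightarrow> (real D + 0) ^ r"
    by (intro tendsto_intros lim_const_over_n)
  ultimately have "real m \<le> (real D + 0) ^ r"
    using tendsto_lowerbound trivial_limit_sequentially by blast
  then show ?thesis
    by (simp flip: of_nat_power)
qed

text \<open>\<open>indep\<close> concerns coefficients indexed by \<open>P\<close>, so it also makes
  \<open>v\<close> injective; the size bound for independent sets inside a span then applies to the
  image of \<open>P\<close>.\<close>

lemma (in vector_space) card_independent_family_le:
  assumes "finite P" "finite T" "v ` P \<subseteq> span T"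
    and indep: "\<And>u p. (\<Sum>p\<in>P. scale (u p) (v p)) = 0 \<Longrightarrow> p \<in> P \<Longrightarrow> u p = 0"
  shows "card P \<le> card T"
proof -
  have inj: "inj_on v P"
  proof (rule inj_onI, rule ccontr)
    fix p q assume pq: "p \<in> P" "q \<in> P" "v p = v q" "p \<noteq> q"
    let ?u = "(\<lambda>_. 0)(p := 1, q := - 1)"
    have "(\<Sum>i\<in>P. scale (?u i) (v i)) = (\<Sum>i\<in>{p, q}. scale (?u i) (v i))"
      using pq \<open>finite P\<close> by (intro sum.mono_neutral_right) auto
    also have "\<dots> = 0"
      using pq by simp
    finally show False
      using indep[of ?u q] pq by simp
  qed
  have "independent (v ` P)"
  proof
    assume "dependent (v ` P)"
    then obtain u p where "(\<Sum>x\<in>v ` P. scale (u x) x) = 0" "p \<in> P" "u (v p) \<noteq> 0"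
      using dependent_finite[of "v ` P"] \<open>finite P\<close> by blast
    then show False
      using indep[of "\<lambda>p. u (v p)" p] by (simp add: sum.reindex[OF inj])
  qed
  then have "card (v ` P) \<le> card T"
    using independent_span_bound assms by blast
  then show ?thesis
    by (simp add: card_image[OF inj])
qed


section \<open>Endomorphisms\<close>

context
  fixes \<phi> :: "('n::{finite,linorder}, 'k::field_char_0) weyl \<Rightarrow> ('n, 'k) weyl"
  assumes endo: "weyl_endomorphism \<phi>"
    and one_neq_zero: "(1::('n, 'k) weyl) \<noteq> 0"
begin

lemma endo_one: "\<phi> 1 = 1"
  and endo_add: "\<phi> (f + g) = \<phi> f + \<phi> g"
  and endo_mult: "\<phi> (f * g) = \<phi> f * \<phi> g"
  and endo_scale: "\<phi> (weyl_const c * f) = weyl_const c * \<phi> f"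
  using endo unfolding weyl_endomorphism_def by blast+

lemma endo_zero: "\<phi> 0 = 0"
  using endo_add[of 0 0] by simp

lemma endo_uminus: "\<phi> (- f) = - \<phi> f"
  using endo_add[of "- f" f] by (simp add: endo_zero eq_neg_iff_add_eq_0)

lemma endo_sum: "\<phi> (sum h I) = (\<Sum>i\<in>I. \<phi> (h i))"
  by (induction I rule: infinite_finite_induct) (simp_all add: endo_zero endo_add)

lemma endo_power: "\<phi> (f ^ k) = \<phi> f ^ k"
  by (induction k) (simp_all add: endo_one endo_mult)

lemma endo_pbw: "\<phi> (weyl_pbw \<gamma>) = ordered_monomial (\<lambda>g. \<phi> (weyl_gen_value g)) weyl_gens \<gamma>"
proof -
  have "\<phi> (ordered_monomial weyl_gen_value L \<gamma>) = ordered_monomial (\<lambda>g. \<phi> (weyl_gen_value g)) L \<gamma>" for L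
    by (induction L) (simp_all add: endo_one endo_mult endo_power)
  then show ?thesis
    by (simp add: weyl_pbw_def)
qed

lemma endo_commutator: "commutator (\<phi> f) (\<phi> g) = \<phi> (commutator f g)"
proof -
  have "\<phi> (f * g + - (g * f)) = \<phi> f * \<phi> g + - (\<phi> g * \<phi> f)"
    by (simp only: endo_add endo_uminus endo_mult)
  then show ?thesis
    by (simp add: commutator_def)
qed

text \<open>The relations between generators and duals pass to their images, so the images of the
  monomials are again independent and the kernel is zero.\<close>

lemma endo_eq_0_iff: "\<phi> f = 0 \<longleftrightarrow> f = 0"
proof
  assume f: "\<phi> f = 0"
  obtain M c where M: "finite M" "f = (\<Sum>\<gamma>\<in>M. weyl_const (c \<gamma>) * weyl_pbw \<gamma>)"
    by (rule weyl_pbw_expansion)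
  have "c \<gamma> = 0" if "\<gamma> \<in> M" for \<gamma>
  proof (rule ordered_monomials_independent[OF distinct_weyl_gens set_weyl_gens _ one_neq_zero M(1) _ that])
    show "commutator (\<phi> (weyl_gen_dual g)) (\<phi> (weyl_gen_value h)) = (if h = g then 1 else 0)" for g h
      unfolding endo_commutator commutator_weyl_gen_dual_value by (simp add: endo_one endo_zero)
    show "(\<Sum>\<gamma>\<in>M. weyl_const (c \<gamma>) * ordered_monomial (\<lambda>g. \<phi> (weyl_gen_value g)) weyl_gens \<gamma>) = 0"
      using f unfolding M(2) by (simp add: endo_sum endo_scale endo_pbw)
  qed
  then show "f = 0"
    unfolding M(2) by (simp add: weyl_const_0)
qed (simp add: endo_zero)

text \<open>Each generator is sent into the step of index \<open>endomorphism_degree \<phi>\<close>,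
  and a monomial of degree at most \<open>N\<close> has at most \<open>N\<close> generators as
  factors.\<close>

lemma endo_filtration:
  assumes "f \<in> weyl_filtration N"
  shows "\<phi> f \<in> weyl_filtration (endomorphism_degree \<phi> * N)"
  using assms
proof (induction rule: weyl_filtration_induct)
  case (base \<gamma>)
  let ?D = "endomorphism_degree \<phi>"
  have "weyl_degree (\<phi> (weyl_gen_value g)) \<le> ?D" for g
    unfolding endomorphism_degree_def by (cases g) (auto intro!: Max_ge)
  then have "\<phi> (weyl_gen_value g) \<in> weyl_filtration ?D" for g
    using mem_weyl_filtration_degree[OF one_neq_zero] weyl_filtration_mono by blast
  then have "\<phi> (weyl_pbw \<gamma>) \<in> weyl_filtration (?D * sum_list (map \<gamma> weyl_gens))"
    unfolding endo_pbw by (rule ordered_monomial_mem_filtration)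
  moreover have "?D * sum_list (map \<gamma> weyl_gens) \<le> ?D * N"
    using base by (simp add: sum_list_distinct_conv_sum_set distinct_weyl_gens set_weyl_gens)
  ultimately show ?case
    using weyl_filtration_mono by blast
qed (auto simp: endo_zero endo_add endo_scale
    intro: weyl_filtration_zero weyl_filtration_add weyl_filtration_scale)

text \<open>\<open>op\<close> stands for multiplication in either order, so one dimension count
  serves both sides. The \<open>a i\<close> are independent over the image of
  \<open>\<phi>\<close>.\<close>

lemma card_le_degree_power:
  fixes op :: "('n, 'k) weyl \<Rightarrow> ('n, 'k) weyl \<Rightarrow> ('n, 'k) weyl"
  assumes "finite I"
    and op_add: "\<And>f g h. op (f + g) h = op f h + op g h"
    and op_scale: "\<And>c f h. op (weyl_const c * f) h = weyl_const c * op f h"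
    and op_filtration: "\<And>f h M N. f \<in> weyl_filtration M \<Longrightarrow> h \<in> weyl_filtration N \<Longrightarrow> op f h \<in> weyl_filtration (M + N)"
    and indep: "\<And>b i. (\<Sum>i\<in>I. op (\<phi> (b i)) (a i)) = 0 \<Longrightarrow> i \<in> I \<Longrightarrow> b i = 0"
  shows "card I \<le> endomorphism_degree \<phi> ^ (2 * CARD('n))"
proof -
  let ?D = "endomorphism_degree \<phi>" and ?r = "CARD('n weyl_gen)"
  have op_zero: "op 0 h = 0" for h
    using op_add[of 0 0 h] by simp
  have op_sum: "op (sum f J) h = (\<Sum>j\<in>J. op (f j) h)" for f h and J :: "('n weyl_gen \<Rightarrow> nat) set"
    by (induction J rule: infinite_finite_induct) (simp_all add: op_zero op_add)
  have "\<forall>i. \<exists>N. a i \<in> weyl_filtration N"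
    using weyl_filtration_exhaust by blast
  then obtain n where n: "\<And>i. a i \<in> weyl_filtration (n i)"
    by metis
  \<comment> \<open>A common filtration index for the finitely many \<open>a i\<close>.\<close>
  define c where "c = (\<Sum>i\<in>I. n i)"
  have c: "a i \<in> weyl_filtration c" if "i \<in> I" for i
    using n[of i] weyl_filtration_mono[of "n i" c] member_le_sum[of i I n] that \<open>finite I\<close>
    by (auto simp: c_def)
  have "card I * ((N + ?r) choose ?r) \<le> (?D * N + c + ?r) choose ?r" for N
  proof -
    define \<Gamma> where "\<Gamma> = (\<lambda>N. {\<gamma> :: 'n weyl_gen \<Rightarrow> nat. sum \<gamma> UNIV \<le> N})"
    have \<Gamma>: "finite (\<Gamma> N)" "card (\<Gamma> N) = (N + ?r) choose ?r" for N
      by (simp_all add: \<Gamma>_def finite_bounded_sum card_bounded_sum)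
    \<comment> \<open>These are the images of the monomial basis of \<open>card I\<close> copies of
      \<open>weyl_filtration N\<close>; they lie in the filtration step
      \<open>?D * N + c\<close>.\<close>
    define v where "v = (\<lambda>(i, \<gamma>). op (\<phi> (weyl_pbw \<gamma>)) (a i))"
    have "card (I \<times> \<Gamma> N) \<le> card (weyl_pbw ` \<Gamma> (?D * N + c) :: ('n, 'k) weyl set)"
    proof (rule weyl.card_independent_family_le)
      show "v ` (I \<times> \<Gamma> N) \<subseteq> weyl.span (weyl_pbw ` \<Gamma> (?D * N + c))"
        unfolding \<Gamma>_def weyl_filtration_def[symmetric]
        by (auto simp: v_def intro!: op_filtration endo_filtration weyl_pbw_mem_filtration c)
      show "u p = 0"
        if u: "(\<Sum>p\<in>I \<times> \<Gamma> N. weyl_const (u p) * v p) = 0" and p: "p \<in> I \<times> \<Gamma> N" for u p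
      proof -
        \<comment> \<open>Grouping coefficients by \<open>i\<close> turns a scalar relation among
          the \<open>v p\<close> into a relation among the \<open>a i\<close> over the image of
          \<open>\<phi>\<close>. Then \<open>indep\<close> gives \<open>b i = 0\<close>, and
          independence of the monomials finishes.\<close>
        define b :: "_ \<Rightarrow> ('n, 'k) weyl" where "b = (\<lambda>i. \<Sum>\<gamma>\<in>\<Gamma> N. weyl_const (u (i, \<gamma>)) * weyl_pbw \<gamma>)"
        have "op (\<phi> (b i)) (a i) = (\<Sum>\<gamma>\<in>\<Gamma> N. weyl_const (u (i, \<gamma>)) * v (i, \<gamma>))" for i
          unfolding b_def v_def by (simp add: endo_sum endo_scale op_sum op_scale)
        then have "(\<Sum>i\<in>I. op (\<phi> (b i)) (a i)) = 0"
          using u by (simp add: sum.cartesian_product)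
        then have "b (fst p) = 0"
          using indep p by auto
        then show ?thesis
          unfolding b_def using weyl_pbw_independent[OF one_neq_zero \<Gamma>(1),
              where c = "\<lambda>\<gamma>. u (fst p, \<gamma>)" and \<gamma> = "snd p"] p by auto
      qed
    qed (use \<open>finite I\<close> \<Gamma> in auto)
    also have "\<dots> \<le> card (\<Gamma> (?D * N + c))"
      by (rule card_image_le) (rule \<Gamma>)
    finally show ?thesis
      by (simp add: card_cartesian_product \<Gamma>)
  qed
  then have "card I \<le> ?D ^ ?r"
    by (rule le_power_of_binomial_growth)
  then show ?thesis
    by (simp add: card_weyl_gen)
qed

end

section \<open>Bounds for the left and the right dimension\<close>

theorem proposition4p2:
  fixes \<phi> :: "('n::{finite,linorder}, 'k::field_char_0) weyl \<Rightarrow> ('n, 'k) weyl"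
    and \<iota> :: "('n, 'k) weyl \<Rightarrow> 'd::division_ring"
  assumes "weyl_endomorphism \<phi>"
    and "division_ring_of_fractions \<iota>"
  shows "left_dim (fractions_of \<iota> (range \<phi>)) \<le> enat (endomorphism_degree \<phi> ^ (2 * CARD('n))) \<and>
         right_dim (fractions_of \<iota> (range \<phi>)) \<le> enat (endomorphism_degree \<phi> ^ (2 * CARD('n)))"
proof
  note \<iota> = assms(2)
  note \<iota>_one = division_ring_of_fractionsD(1)[OF \<iota>]
    and \<iota>_mult = division_ring_of_fractionsD(3)[OF \<iota>]
    and \<iota>_sum = division_ring_of_fractions_sum[OF \<iota>]
    and \<iota>_zero = division_ring_of_fractions_zero[OF \<iota>]
    and \<iota>_eq_0 = division_ring_of_fractions_eq_0_iff[OF \<iota>]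
  \<comment> \<open>\<open>\<iota>\<close> sends \<open>1\<close> to \<open>1\<close> and
    \<open>0\<close> to \<open>0\<close>, and these differ in a division ring.\<close>
  have one: "(1::('n, 'k) weyl) \<noteq> 0"
    using \<iota>_one \<iota>_zero by auto
  note endo = endo_one[OF assms(1) one] endo_mult[OF assms(1) one] endo_uminus[OF assms(1) one]
    endo_eq_0_iff[OF assms(1) one]
  define E where "E = fractions_of \<iota> (range \<phi>)"
  note E_image = image_mem_fractions_of_range[OF \<iota> endo, folded E_def]
    and E_one = one_mem_fractions_of_range[OF \<iota> endo, folded E_def]
    and E_zero = zero_mem_fractions_of_range[OF \<iota> endo, folded E_def]
    and E_mult = fractions_of_range_mult[OF \<iota> endo, folded E_def]
    and E_inverse = fractions_of_range_inverse[OF \<iota> endo, folded E_def]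
    and E_uminus = fractions_of_range_uminus[OF \<iota> endo, folded E_def]
  have "left_dim E \<le> enat (endomorphism_degree \<phi> ^ (2 * CARD('n)))"
    unfolding left_dim_def
  proof (rule dim_over_le)
    show "\<exists>e\<in>E. \<forall>v. a * (e * v) = - (b * v)" if "a \<in> E" "b \<in> E" "a \<noteq> 0" for a b
      using that E_mult E_inverse E_uminus
      by (intro bexI[of _ "- (inverse a * b)"]) (simp_all add: mult.assoc[symmetric])
    show "card B \<le> endomorphism_degree \<phi> ^ (2 * CARD('n))"
      if B: "finite B" "independent_over E (*) B" for B
    proof -
      \<comment> \<open>Denominators are cleared on the right, away from the scalars. A relation
        among the \<open>a q\<close> then becomes one among the elements of \<open>B\<close> after
        cancelling \<open>\<iota> s\<close>.\<close>
      obtain s where s: "s \<noteq> 0" "\<forall>q\<in>B. q * \<iota> s \<in> range \<iota>"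
        using common_right_denominator[OF \<iota> B(1)] by blast
      then have "\<forall>q\<in>B. \<exists>a. \<iota> a = q * \<iota> s"
        by (metis rangeE)
      then obtain a where a: "\<And>q. q \<in> B \<Longrightarrow> \<iota> (a q) = q * \<iota> s"
        by metis
      show ?thesis
      proof (rule card_le_degree_power[OF assms(1) one B(1), of "(*)" a])
        fix b q assume b: "(\<Sum>q\<in>B. \<phi> (b q) * a q) = 0" and q: "q \<in> B"
        have "(\<Sum>q\<in>B. \<iota> (\<phi> (b q)) * q) * \<iota> s = \<iota> (\<Sum>q\<in>B. \<phi> (b q) * a q)"
          by (simp add: \<iota>_sum \<iota>_mult a sum_distrib_right mult.assoc)
        then have "(\<Sum>q\<in>B. \<iota> (\<phi> (b q)) * q) = 0"
          using s(1) by (simp add: b \<iota>_zero \<iota>_eq_0)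
        then have "\<iota> (\<phi> (b q)) = 0"
          using independent_overD[OF B(2,1), of "\<lambda>q. \<iota> (\<phi> (b q))", OF E_image _ q] by simp
        then show "b q = 0"
          by (simp add: \<iota>_eq_0 endo)
      qed (simp_all add: distrib_right mult.assoc weyl_filtration_mult)
    qed
  qed (use E_one E_zero in \<open>auto simp: distrib_left\<close>)
  then show "left_dim (fractions_of \<iota> (range \<phi>)) \<le> enat (endomorphism_degree \<phi> ^ (2 * CARD('n)))"
    by (simp add: E_def)
  have "right_dim E \<le> enat (endomorphism_degree \<phi> ^ (2 * CARD('n)))"
    unfolding right_dim_def
  proof (rule dim_over_le)
    show "\<exists>e\<in>E. \<forall>v. v * e * a = - (v * b)" if "a \<in> E" "b \<in> E" "a \<noteq> 0" for a b
      using that E_mult E_inverse E_uminus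
      by (intro bexI[of _ "- (b * inverse a)"]) (simp_all add: mult.assoc)
    show "card B \<le> endomorphism_degree \<phi> ^ (2 * CARD('n))"
      if B: "finite B" "independent_over E (\<lambda>c v. v * c) B" for B
    proof -
      obtain s where s: "s \<noteq> 0" "\<forall>q\<in>B. \<iota> s * q \<in> range \<iota>"
        using common_left_denominator[OF \<iota> B(1)] by blast
      then have "\<forall>q\<in>B. \<exists>a. \<iota> a = \<iota> s * q"
        by (metis rangeE)
      then obtain a where a: "\<And>q. q \<in> B \<Longrightarrow> \<iota> (a q) = \<iota> s * q"
        by metis
      \<comment> \<open>With \<open>op\<close> as reversed multiplication the scalars
        \<open>\<phi> (b q)\<close> stand on the right.\<close>
      show ?thesis
      proof (rule card_le_degree_power[OF assms(1) one B(1), of "\<lambda>x y. y * x" a])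
        show "h * f \<in> weyl_filtration (M + N)"
          if "f \<in> weyl_filtration M" "h \<in> weyl_filtration N" for f h :: "('n, 'k) weyl" and M N
          using weyl_filtration_mult[OF that(2,1)] by (simp add: add.commute)
        fix b q assume b: "(\<Sum>q\<in>B. a q * \<phi> (b q)) = 0" and q: "q \<in> B"
        have "\<iota> s * (\<Sum>q\<in>B. q * \<iota> (\<phi> (b q))) = \<iota> (\<Sum>q\<in>B. a q * \<phi> (b q))"
          by (simp add: \<iota>_sum \<iota>_mult a sum_distrib_left mult.assoc)
        then have "(\<Sum>q\<in>B. q * \<iota> (\<phi> (b q))) = 0"
          using s(1) by (simp add: b \<iota>_zero \<iota>_eq_0)
        then have "\<iota> (\<phi> (b q)) = 0"
          using independent_overD[OF B(2,1), of "\<lambda>q. \<iota> (\<phi> (b q))", OF E_image _ q] by simp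
        then show "b q = 0"
          by (simp add: \<iota>_eq_0 endo)
      qed (simp_all add: distrib_left weyl_const_left_commute)
    qed
  qed (use E_one E_zero in \<open>auto simp: distrib_right\<close>)
  then show "right_dim (fractions_of \<iota> (range \<phi>)) \<le> enat (endomorphism_degree \<phi> ^ (2 * CARD('n)))"
    by (simp add: E_def)
qed

end
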